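(* Let $\nu>-1$. Then for every integer $n\ge1$, $$\sum_{k \ge 1} \frac{1}{\Big[ \big(j_n^{\nu+2}\big)^2- \big(j_k^{\nu}\big)^2\Big]^2} = \frac{1}{16(\nu+1)^2}.$$
   Context: For $\mu>-1$, $\{j_n^{\mu}: n\ge1\}$ denotes the sequence of strictly positive zeros, in ascending order, of the Bessel function of the first kind $J_\mu$. *)

theory Defs
  imports "HOL-Analysis.Analysis"
begin

(* Only meant for x > 0, where the factor (x/2) powr \<mu> is the usual real power. *)
definition bessel_J :: "real \<Rightarrow> real \<Rightarrow> real" where
  "bessel_J \<mu> x =
     (\<Sum>m. (-1) ^ m / fact m * rGamma (real m + \<mu> + 1) * (x / 2) powr (2 * real m + \<mu>))"

(* The count in the definition includes x itself, so indexing starts at n = 1.  An infinite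
   set has card 0, so for n \<ge> 1 the last conjunct also makes the counted set finite. *)
definition bessel_zero :: "real \<Rightarrow> nat \<Rightarrow> real" where
  "bessel_zero \<mu> n =
     (THE x. 0 < x \<and> bessel_J \<mu> x = 0 \<and> card {y. 0 < y \<and> y \<le> x \<and> bessel_J \<mu> y = 0} = n)"

end

theory Submission
  imports Defs
begin

text \<open>
  In the variable \<open>z = x\<^sup>2 / 4\<close>, and up to a factor without zeros, the Bessel function \<open>J\<^sub>\<nu>\<close> is
  \<open>g\<^sub>a(z) = \<Sum>m. (-z) ^ m / (m! (a)\<^sub>m)\<close> with \<open>a = \<nu> + 1 > 0\<close>. It satisfies
  \<open>g\<^sub>a' = - g\<^sub>a\<^sub>+\<^sub>1 / a\<close> and \<open>z g\<^sub>a'' + a g\<^sub>a' + g\<^sub>a = 0\<close>; in particular \<open>g\<^sub>a''\<close> is a multiple of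
  \<open>g\<^sub>a\<^sub>+\<^sub>2\<close>. If \<open>z\<^sub>1, z\<^sub>2, \<dots>\<close> are the positive zeros of \<open>g\<^sub>a\<close>, then
  \<open>\<Sum>k. 1 / (w - z\<^sub>k)\<^sup>2 = (g\<^sub>a' / g\<^sub>a)\<^sup>2 - g\<^sub>a'' / g\<^sub>a\<close> at \<open>w\<close> (\<open>has_sum_resolvent\<close>). At a zero \<open>w\<close> of
  \<open>g\<^sub>a\<^sub>+\<^sub>2\<close> the second derivative vanishes, the differential equation gives \<open>g\<^sub>a' / g\<^sub>a = - 1 / a\<close>, and
  the sum is \<open>1 / a\<^sup>2\<close>. Returning to \<open>x\<close> contributes the factor \<open>1 / 16\<close>.

  The expansion is obtained by real analysis alone, as a limit of the same identity for polynomials.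
  The Laguerre polynomials \<open>l\<^sub>n(u) = \<Sum>m. (n choose m) (-u) ^ m / (a)\<^sub>m\<close> have \<open>n\<close> distinct positive
  roots, by Rolle's theorem applied to \<open>x powr (n + a) * exp (- x) * l\<^sub>n(x)\<close> (\<open>laguerre_roots_ex\<close>), so
  the identity holds for \<open>p\<^sub>n(z) = l\<^sub>n(z / n)\<close> with sums over the roots of \<open>p\<^sub>n\<close>. Both \<open>p\<^sub>n\<close> and \<open>p\<^sub>n'\<close>
  converge uniformly on bounded intervals to \<open>g\<^sub>a\<close> and \<open>g\<^sub>a'\<close>. The zeros of \<open>g\<^sub>a\<close> are simple, so each
  of them is the limit of exactly one root of \<open>p\<^sub>n\<close>, and no other roots accumulate at a finite
  point. No mass escapes to infinity either: the sum of \<open>1 / x\<close> over the roots of \<open>p\<^sub>n\<close>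
  equals \<open>1 / a\<close> for every \<open>n \<ge> 1\<close>, so roots beyond \<open>R\<close> contribute at most \<open>4 / (R * a)\<close>. The two
  inequalities are \<open>sum_zeros_le\<close> and \<open>resolvent_value_le\<close>.

  The same inequalities show that the zeros are locally finite and infinite in number, so that
  \<open>bessel_zero\<close> really enumerates them.
\<close>

section \<open>The entire function behind the Bessel function\<close>

definition bessel_coeff :: "real \<Rightarrow> nat \<Rightarrow> real" where
  "bessel_coeff a m = (-1) ^ m / (fact m * pochhammer a m)"

text \<open>The hypergeometric function \<open>0F1(;a;-z)\<close>: up to the factor
\<open>rGamma (\<mu> + 1) * (x / 2) powr \<mu>\<close>, which has no zeros, it is \<open>J\<^sub>\<mu>\<close> in the variable
\<open>z = x\<^sup>2 / 4\<close> with \<open>a = \<mu> + 1\<close>.\<close>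

definition bessel_entire :: "real \<Rightarrow> real \<Rightarrow> real" where
  "bessel_entire a z = (\<Sum>m. bessel_coeff a m * z ^ m)"

lemma pochhammer_ge_min:
  fixes a :: real
  assumes "a > 0"
  shows "min 1 a \<le> pochhammer a m"
proof (cases m)
  case (Suc k)
  have "1 \<le> pochhammer (a + 1) k"
    unfolding pochhammer_prod by (rule prod_ge_1) (use assms in auto)
  then show ?thesis
    using Suc assms by (simp add: pochhammer_rec min_le_iff_disj)
qed auto

lemma bessel_coeff_bound:
  assumes "a > 0"
  shows "\<bar>bessel_coeff a m\<bar> \<le> inverse (fact m) * inverse (min 1 a)"
proof -
  have "inverse (pochhammer a m) \<le> inverse (min 1 a)"
    by (rule le_imp_inverse_le) (use pochhammer_ge_min[OF assms] assms in auto)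
  moreover have "\<bar>bessel_coeff a m\<bar> = inverse (fact m) * inverse (pochhammer a m)"
    using pochhammer_pos[OF assms, of m]
    by (simp add: bessel_coeff_def abs_mult divide_inverse power_abs)
  ultimately show ?thesis
    by (simp add: mult_left_mono)
qed

lemma summable_abs_bessel_coeff:
  assumes "a > 0"
  shows "summable (\<lambda>m. \<bar>bessel_coeff a m\<bar> * \<bar>z\<bar> ^ m)"
proof (rule summable_comparison_test')
  show "summable (\<lambda>m. inverse (min 1 a) * (inverse (fact m) * \<bar>z\<bar> ^ m))"
    by (intro summable_mult summable_exp)
  show "norm (\<bar>bessel_coeff a m\<bar> * \<bar>z\<bar> ^ m) \<le> inverse (min 1 a) * (inverse (fact m) * \<bar>z\<bar> ^ m)" for m
    using mult_right_mono[OF bessel_coeff_bound[OF assms, of m], of "\<bar>z\<bar> ^ m"]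
    by (simp add: abs_mult power_abs mult_ac)
qed

lemma summable_bessel_coeff:
  assumes "a > 0"
  shows "summable (\<lambda>m. bessel_coeff a m * z ^ m)"
  by (rule summable_norm_cancel)
     (use summable_abs_bessel_coeff[OF assms, of z] in \<open>simp add: abs_mult power_abs\<close>)

lemma bessel_entire_0 [simp]: "bessel_entire a 0 = 1"
  using powser_zero[of "bessel_coeff a"] by (simp add: bessel_entire_def bessel_coeff_def)

lemma diffs_bessel_coeff: "a > 0 \<Longrightarrow> diffs (bessel_coeff a) m = - bessel_coeff (a + 1) m / a"
  by (simp add: diffs_def bessel_coeff_def pochhammer_rec field_simps del: of_nat_Suc)

lemma DERIV_bessel_entire:
  assumes "a > 0"
  shows "(bessel_entire a has_real_derivative - bessel_entire (a + 1) z / a) (at z)"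
proof -
  have "((\<lambda>z. \<Sum>m. bessel_coeff a m * z ^ m) has_real_derivative
          (\<Sum>m. diffs (bessel_coeff a) m * z ^ m)) (at z)"
    by (rule termdiffs_strong_converges_everywhere) (rule summable_bessel_coeff[OF assms])
  moreover have "(\<Sum>m. diffs (bessel_coeff a) m * z ^ m) = - bessel_entire (a + 1) z / a"
    using suminf_mult[OF summable_bessel_coeff[of "a + 1" z], of "- (1 / a)"] assms
    by (simp add: diffs_bessel_coeff[OF assms] bessel_entire_def mult_ac)
  ultimately show ?thesis
    by (simp add: bessel_entire_def[abs_def])
qed

lemma isCont_bessel_entire: "a > 0 \<Longrightarrow> isCont (bessel_entire a) z"
  by (rule DERIV_isCont[OF DERIV_bessel_entire])

lemma continuous_on_bessel_entire: "a > 0 \<Longrightarrow> continuous_on A (bessel_entire a)"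
  by (simp add: continuous_at_imp_continuous_on isCont_bessel_entire)

text \<open>Since \<open>g\<^sub>a' = - g\<^sub>a\<^sub>+\<^sub>1 / a\<close>, this three-term relation is the differential equation
\<open>z g'' + a g' + g = 0\<close> written without derivatives.\<close>

lemma bessel_entire_contiguous:
  assumes "a > 0"
  shows "bessel_entire a z - bessel_entire (a + 1) z
           = - z * bessel_entire (a + 2) z / (a * (a + 1))"
proof -
  let ?d = "\<lambda>m. bessel_coeff a m - bessel_coeff (a + 1) m"
  have step: "?d (Suc m) = - bessel_coeff (a + 2) m / (a * (a + 1))" for m
  proof -
    define q where "q = pochhammer (a + 2) m"
    have q: "q > 0" unfolding q_def using assms by (intro pochhammer_pos) auto
    have p1: "pochhammer (a + 1) (Suc m) = (a + 1) * q"
      by (simp add: pochhammer_rec q_def add.assoc)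
    have "pochhammer (a + 1) m * (a + 1 + real m) = (a + 1) * q"
      using p1 by (simp add: pochhammer_Suc)
    hence p2: "pochhammer a (Suc m) = a * (a + 1) * q / (a + 1 + real m)"
      using assms by (simp add: pochhammer_rec field_simps)
    show ?thesis
      using assms q
      unfolding bessel_coeff_def p1 p2 q_def[symmetric] fact_Suc
      by (simp add: divide_simps) (simp add: algebra_simps)
  qed
  have s: "summable (\<lambda>m. ?d m * z ^ m)"
    using summable_diff[OF summable_bessel_coeff[of a z] summable_bessel_coeff[of "a + 1" z]] assms
    by (simp add: algebra_simps)
  have "bessel_entire a z - bessel_entire (a + 1) z = (\<Sum>m. ?d m * z ^ m)"
    using suminf_diff[OF summable_bessel_coeff[of a z] summable_bessel_coeff[of "a + 1" z]] assms
    by (simp add: bessel_entire_def algebra_simps)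
  also have "\<dots> = (\<Sum>m. ?d (Suc m) * z ^ Suc m)"
    using suminf_split_head[OF s] by (simp add: bessel_coeff_def)
  also have "\<dots> = (\<Sum>m. (- z / (a * (a + 1))) * (bessel_coeff (a + 2) m * z ^ m))"
    unfolding step by (intro suminf_cong) simp
  also have "\<dots> = (- z / (a * (a + 1))) * bessel_entire (a + 2) z"
    unfolding bessel_entire_def using assms
    by (intro suminf_mult summable_bessel_coeff) auto
  finally show ?thesis by simp
qed

text \<open>All coefficients but the constant one tend to 0 as the parameter grows, under the common
bound \<open>inverse (fact m)\<close>, so Tannery's theorem applies.\<close>

lemma bessel_entire_large_parameter:
  assumes "a > 0"
  shows "(\<lambda>k. bessel_entire (a + real k) z) \<longlonglongrightarrow> 1"
proof -
  have "(\<lambda>k. bessel_entire (a + real (Suc k)) z) \<longlonglongrightarrow> (\<Sum>m. if m = 0 then 1 else 0 :: real)"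
    unfolding bessel_entire_def
  proof (rule tannerys_theorem[THEN conjunct2, THEN conjunct2])
    show "summable (\<lambda>m. inverse (fact m) * \<bar>z\<bar> ^ m)"
      by (rule summable_exp)
    show "\<forall>\<^sub>F (m, k) in sequentially \<times>\<^sub>F sequentially.
            norm (bessel_coeff (a + real (Suc k)) m * z ^ m) \<le> inverse (fact m) * \<bar>z\<bar> ^ m"
    proof (intro always_eventually allI, clarify)
      fix m k
      have "\<bar>bessel_coeff (a + real (Suc k)) m\<bar> \<le> inverse (fact m)"
        using bessel_coeff_bound[of "a + real (Suc k)" m] assms by (simp add: min_def)
      from mult_right_mono[OF this, of "\<bar>z\<bar> ^ m"]
      show "norm (bessel_coeff (a + real (Suc k)) m * z ^ m) \<le> inverse (fact m) * \<bar>z\<bar> ^ m"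
        by (simp add: abs_mult power_abs)
    qed
    show "(\<lambda>k. bessel_coeff (a + real (Suc k)) m * z ^ m) \<longlonglongrightarrow> (if m = 0 then 1 else 0)" for m
    proof (cases m)
      case (Suc j)
      have "(\<lambda>k. bessel_coeff (a + real (Suc k)) m) \<longlonglongrightarrow> 0"
      proof (rule tendsto_sandwich[of "\<lambda>k. - (1 / real (Suc k))" _ _ "\<lambda>k. 1 / real (Suc k)"])
        have *: "\<bar>bessel_coeff (a + real (Suc k)) m\<bar> \<le> 1 / real (Suc k)" for k
        proof -
          have "1 \<le> pochhammer (a + real (Suc k) + 1) j"
            using pochhammer_ge_min[of "a + real (Suc k) + 1" j] assms by simp
          hence "(a + real (Suc k)) * 1 \<le> pochhammer (a + real (Suc k)) m"
            unfolding Suc pochhammer_rec using assms by (intro mult_left_mono) auto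
          hence "real (Suc k) \<le> pochhammer (a + real (Suc k)) m"
            using assms by simp
          moreover have "1 \<le> (fact m :: real)" by simp
          ultimately have "1 * real (Suc k) \<le> fact m * pochhammer (a + real (Suc k)) m"
            by (intro mult_mono) auto
          hence "1 / (fact m * pochhammer (a + real (Suc k)) m) \<le> 1 / real (Suc k)"
            by (intro divide_left_mono) (auto intro!: mult_pos_pos pochhammer_pos add_pos_pos assms)
          moreover have "pochhammer (a + real (Suc k)) m > 0"
            using assms by (intro pochhammer_pos) auto
          ultimately show ?thesis
            by (simp add: bessel_coeff_def abs_mult power_abs)
        qed
        show "\<forall>\<^sub>F k in sequentially. - (1 / real (Suc k)) \<le> bessel_coeff (a + real (Suc k)) m"
          using * by (intro always_eventually allI) (metis abs_le_iff minus_le_iff)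
        show "\<forall>\<^sub>F k in sequentially. bessel_coeff (a + real (Suc k)) m \<le> 1 / real (Suc k)"
          using * by (intro always_eventually allI) (metis abs_le_iff)
        show "(\<lambda>k. 1 / real (Suc k)) \<longlonglongrightarrow> 0"
          using LIMSEQ_inverse_real_of_nat by (simp add: divide_inverse)
        then show "(\<lambda>k. - (1 / real (Suc k))) \<longlonglongrightarrow> 0"
          using tendsto_minus by fastforce
      qed
      from tendsto_mult_right[OF this, of "z ^ m"] show ?thesis
        by (simp add: Suc)
    qed (simp add: bessel_coeff_def)
  qed simp
  hence "(\<lambda>k. bessel_entire (a + real (Suc k)) z) \<longlonglongrightarrow> 1"
    using suminf_finite[of "{0::nat}" "\<lambda>m. if m = 0 then 1 else 0 :: real"] by simp
  thus ?thesis
    by (subst (asm) filterlim_sequentially_Suc)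
qed

text \<open>The derivative is a multiple of \<open>bessel_entire (a + 1)\<close>, so this says that nonzero zeros
are simple. If two consecutive parameters vanished at \<open>z\<close>, the contiguous relation would
propagate the zero to all parameters \<open>a + k\<close>, against the limit 1.\<close>

lemma bessel_entire_simple_zero:
  assumes "a > 0" "z \<noteq> 0" "bessel_entire a z = 0"
  shows "bessel_entire (a + 1) z \<noteq> 0"
proof
  assume *: "bessel_entire (a + 1) z = 0"
  have "bessel_entire (a + real k) z = 0 \<and> bessel_entire (a + real (Suc k)) z = 0" for k
  proof (induction k)
    case (Suc k)
    have "bessel_entire (a + real k + 2) z = 0"
      using bessel_entire_contiguous[of "a + real k" z] Suc assms
      by (simp add: add_ac)
    with Suc show ?case by (simp add: add_ac)
  qed (use assms * in auto)
  hence "(\<lambda>k. 0) \<longlonglongrightarrow> (1::real)"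
    using bessel_entire_large_parameter[OF assms(1), of z] by simp
  thus False
    using LIMSEQ_unique[OF tendsto_const[of "0::real"]] by force
qed

lemma bessel_J_eq_bessel_entire:
  assumes "\<mu> > -1" "x > 0"
  shows "bessel_J \<mu> x = rGamma (\<mu> + 1) * (x / 2) powr \<mu> * bessel_entire (\<mu> + 1) (x\<^sup>2 / 4)"
proof -
  have "(-1) ^ m / fact m * rGamma (real m + \<mu> + 1) * (x / 2) powr (2 * real m + \<mu>)
          = rGamma (\<mu> + 1) * (x / 2) powr \<mu> * (bessel_coeff (\<mu> + 1) m * (x\<^sup>2 / 4) ^ m)" for m
  proof -
    have "pochhammer (\<mu> + 1) m > 0" using assms by (intro pochhammer_pos) auto
    moreover have "rGamma (\<mu> + 1) = pochhammer (\<mu> + 1) m * rGamma (real m + \<mu> + 1)"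
      using pochhammer_rGamma[of "\<mu> + 1" m] by (simp add: add_ac)
    moreover have "(x / 2) powr (2 * real m + \<mu>) = (x / 2) powr \<mu> * (x\<^sup>2 / 4) ^ m"
    proof -
      have "(x / 2) powr (2 * real m) = (x / 2) ^ (2 * m)"
        using assms powr_realpow[of "x / 2" "2 * m"] by simp
      also have "\<dots> = (x\<^sup>2 / 4) ^ m"
        by (simp add: power_mult power_divide)
      finally show ?thesis by (simp add: powr_add)
    qed
    ultimately show ?thesis
      by (simp add: bessel_coeff_def)
  qed
  thus ?thesis
    unfolding bessel_J_def
    using suminf_mult[OF summable_bessel_coeff[of "\<mu> + 1" "x\<^sup>2 / 4"]] assms
    by (simp add: bessel_entire_def)
qed

lemma bessel_J_zero_iff:
  assumes "\<mu> > -1" "x > 0"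
  shows "bessel_J \<mu> x = 0 \<longleftrightarrow> bessel_entire (\<mu> + 1) (x\<^sup>2 / 4) = 0"
proof -
  have "rGamma (\<mu> + 1) \<noteq> 0"
    using assms Gamma_real_pos[of "\<mu> + 1"] by (simp add: Gamma_def)
  thus ?thesis
    using assms by (simp add: bessel_J_eq_bessel_entire)
qed

section \<open>Laguerre polynomials and their roots\<close>

text \<open>In classical notation this is \<open>L\<^sub>n\<^sup>(\<^sup>a\<^sup>-\<^sup>1\<^sup>)\<close> divided by its value at 0, that is,
\<open>1F1(-n;a;u)\<close>. The normalisation makes the values at 0 agree with \<open>bessel_entire a 0 = 1\<close>.\<close>

definition laguerre :: "real \<Rightarrow> nat \<Rightarrow> real poly" where
  "laguerre a n = (\<Sum>m\<le>n. monom ((-1) ^ m * real (n choose m) / pochhammer a m) m)"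

lemma coeff_laguerre:
  "coeff (laguerre a n) m = (-1) ^ m * real (n choose m) / pochhammer a m"
  by (cases "m \<le> n") (auto simp: laguerre_def coeff_sum if_distrib cong: if_cong)

lemma degree_laguerre: "a > 0 \<Longrightarrow> degree (laguerre a n) = n"
  using pochhammer_pos[of a n]
  by (intro antisym degree_le le_degree) (auto simp: coeff_laguerre)

lemma laguerre_nonzero: "a > 0 \<Longrightarrow> laguerre a n \<noteq> 0"
  using coeff_laguerre[of a n 0] by force

lemma poly_laguerre_0 [simp]: "poly (laguerre a n) 0 = 1"
  by (simp add: poly_0_coeff_0 coeff_laguerre)

lemma binomial_Suc_real:
  "(real k + 1) * real (n choose Suc k) = (real n - real k) * real (n choose k)"
proof -
  have "real (Suc k * (n choose Suc k)) = real ((n - k) * (n choose k))"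
    by (metis binomial_absorb_comp binomial_absorption)
  thus ?thesis
    by (cases "k \<le> n") (auto simp: of_nat_diff algebra_simps)
qed

text \<open>The right-hand side is, up to a positive factor, the derivative of
\<open>x powr (n + a) * exp (- x) * laguerre a n x\<close>; this is what lets Rolle's theorem
produce the roots of the next polynomial.\<close>

lemma laguerre_rec:
  assumes "a > 0"
  shows "(real n + a) * poly (laguerre a (Suc n)) x
           = x * poly (pderiv (laguerre a n)) x + (real n + a - x) * poly (laguerre a n) x"
proof -
  have "smult (real n + a) (laguerre a (Suc n))
          = pCons 0 (pderiv (laguerre a n)) + smult (real n + a) (laguerre a n) - pCons 0 (laguerre a n)"
  proof (rule poly_eqI)
    fix m
    show "coeff (smult (real n + a) (laguerre a (Suc n))) m = coeff (pCons 0 (pderiv (laguerre a n))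
            + smult (real n + a) (laguerre a n) - pCons 0 (laguerre a n)) m"
    proof (cases m)
      case (Suc k)
      define q where "q = pochhammer a k"
      have q: "q > 0" using assms by (simp add: q_def pochhammer_pos)
      have p: "pochhammer a (Suc k) = q * (a + real k)"
        by (simp add: pochhammer_Suc q_def)
      note * = binomial_Suc_real[of k n]
      define B C where "B = real (n choose Suc k)" and "C = real (n choose k)"
      have *: "real k * B = (real n - real k) * C - B" using * by (simp add: B_def C_def algebra_simps)
      have ak: "a + real k > 0" using assms by simp
      define s U V W where "s = (-1 :: real) ^ k" and "U = (C + B) / (q * (a + real k))"
        and "V = B / (q * (a + real k))" and "W = C / q"
      have main: "(real n + a) * U = (real k + 1) * V + (real n + a) * V + W"
        unfolding U_def V_def W_def using q ak * by (simp add: divide_simps) (simp add: algebra_simps)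
      have c: "coeff (laguerre a (Suc n)) (Suc k) = - s * U" "coeff (laguerre a n) (Suc k) = - s * V"
        "coeff (laguerre a n) k = s * W"
        by (simp_all add: coeff_laguerre p s_def U_def V_def W_def B_def C_def q_def)
      have "- s * ((real n + a) * U) = - s * ((real k + 1) * V + (real n + a) * V + W)"
        by (simp only: main)
      thus ?thesis
        by (simp add: Suc coeff_pderiv c algebra_simps)
    qed (simp add: coeff_laguerre)
  qed
  from arg_cong[OF this, of "\<lambda>p. poly p x"] show ?thesis
    by (simp add: algebra_simps)
qed

lemma laguerre_ode:
  assumes "a > 0"
  shows "x * poly (pderiv (pderiv (laguerre a n))) x + (a - x) * poly (pderiv (laguerre a n)) x
           + real n * poly (laguerre a n) x = 0"
proof -
  let ?L = "laguerre a n"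
  have "pCons 0 (pderiv (pderiv ?L)) + smult a (pderiv ?L) - pCons 0 (pderiv ?L) + smult (real n) ?L = 0"
  proof (rule poly_eqI)
    fix m
    have rec: "(real m + 1) * (a + real m) * coeff ?L (Suc m) = - (real n - real m) * coeff ?L m"
    proof -
      define q where "q = pochhammer a m"
      have q: "q > 0" using assms by (simp add: q_def pochhammer_pos)
      have p: "pochhammer a (Suc m) = q * (a + real m)"
        by (simp add: pochhammer_Suc q_def)
      have am: "a + real m > 0" using assms by simp
      note * = binomial_Suc_real[of m n]
      have "(real m + 1) * (a + real m) * coeff ?L (Suc m)
              = - ((-1) ^ m) * ((real m + 1) * real (n choose Suc m)) / q"
        using am q by (simp add: coeff_laguerre p divide_simps)
      also have "\<dots> = - (real n - real m) * coeff ?L m"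
        unfolding * using q by (simp add: coeff_laguerre q_def[symmetric] field_simps)
      finally show ?thesis .
    qed
    show "coeff (pCons 0 (pderiv (pderiv ?L)) + smult a (pderiv ?L) - pCons 0 (pderiv ?L)
            + smult (real n) ?L) m = coeff 0 m"
      using rec by (cases m) (simp_all add: coeff_pderiv algebra_simps)
  qed
  from arg_cong[OF this, of "\<lambda>p. poly p x"] show ?thesis
    by (simp add: algebra_simps)
qed

text \<open>A maximum of \<open>f\<^sup>2\<close> on a long interval is interior, because \<open>f\<close> vanishes at \<open>c\<close> and is
small far out. Squaring avoids distinguishing the sign of \<open>f\<close>.\<close>

lemma Rolle_at_top:
  fixes f :: "real \<Rightarrow> real"
  assumes cont: "continuous_on {c..} f" and "f c = 0" and lim: "(f \<longlongrightarrow> 0) at_top"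
    and der: "\<And>x. x > c \<Longrightarrow> (f has_real_derivative f' x) (at x)"
  shows "\<exists>x>c. f' x = 0"
proof (cases "f (c + 1) = 0")
  case True
  have "\<exists>z. c < z \<and> z < c + 1 \<and> (*) (f' z) = (\<lambda>v. 0)"
  proof (rule Rolle_deriv)
    show "(f has_derivative (*) (f' x)) (at x)" if "c < x" for x
      using der[OF that] by (simp add: has_field_derivative_def)
  qed (use True assms in \<open>auto intro: continuous_on_subset\<close>)
  thus ?thesis by (metis mult.right_neutral)
next
  case False
  define g where "g = (\<lambda>x. (f x)\<^sup>2)"
  have "(g \<longlongrightarrow> 0\<^sup>2) at_top"
    unfolding g_def by (intro tendsto_intros lim)
  hence "eventually (\<lambda>x. g x < g (c + 1)) at_top"
    using False by (intro order_tendstoD(2)[of _ 0]) (auto simp: g_def)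
  then obtain d where d: "d > c + 1" "g d < g (c + 1)"
    by (metis (mono_tags, lifting) eventually_at_top_linorder gt_ex le_cases less_le_trans linorder_not_less)
  have "continuous_on {c..d} g"
    unfolding g_def by (intro continuous_intros continuous_on_subset[OF cont]) auto
  then obtain m where m: "m \<in> {c..d}" "\<And>x. x \<in> {c..d} \<Longrightarrow> g x \<le> g m"
    using continuous_attains_sup[of "{c..d}" g] d by auto
  have "g (c + 1) \<le> g m" using m(2)[of "c + 1"] d by auto
  moreover have "0 < g (c + 1)" using False by (simp add: g_def)
  ultimately have "m \<noteq> c" "m \<noteq> d" using d assms(2) by (auto simp: g_def)
  hence md: "c < m" "m < d" using m(1) by auto
  have "(g has_real_derivative 2 * f m * f' m) (at m)"
    unfolding g_def by (rule derivative_eq_intros der md refl)+ simp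
  hence "2 * f m * f' m = 0"
  proof (rule DERIV_local_max)
    show "0 < min (m - c) (d - m)" using md by auto
    show "\<forall>y. \<bar>m - y\<bar> < min (m - c) (d - m) \<longrightarrow> g y \<le> g m"
      by (auto intro!: m(2))
  qed
  moreover have "f m \<noteq> 0"
    using \<open>g (c + 1) \<le> g m\<close> \<open>0 < g (c + 1)\<close> by (auto simp: g_def)
  ultimately show ?thesis using md by auto
qed

lemma Rolle_finite:
  fixes f :: "real \<Rightarrow> real"
  assumes "finite A" "A \<noteq> {}" "A \<subseteq> {c..}" "\<And>x. x \<in> A \<Longrightarrow> f x = 0"
    and cont: "continuous_on {c..} f"
    and der: "\<And>x. x > c \<Longrightarrow> (f has_real_derivative f' x) (at x)"
  shows "\<exists>B. finite B \<and> Suc (card B) = card A \<and> B \<subseteq> {c<..<Max A} \<and> (\<forall>x\<in>B. f' x = 0)"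
  using assms(1-4)
proof (induction A rule: finite_linorder_max_induct)
  case (insert b A)
  show ?case
  proof (cases "A = {}")
    case False
    then obtain B where B: "finite B" "Suc (card B) = card A" "B \<subseteq> {c<..<Max A}" "\<forall>x\<in>B. f' x = 0"
      using insert by auto
    define M where "M = Max A"
    have M: "M \<in> A" using insert.hyps False by (simp add: M_def)
    have M: "M \<in> A" "M < b" "M \<ge> c" using M insert by auto
    have "\<exists>z. M < z \<and> z < b \<and> (*) (f' z) = (\<lambda>v. 0)"
    proof (rule Rolle_deriv)
      show "(f has_derivative (*) (f' x)) (at x)" if "M < x" for x
        using der[of x] that M by (simp add: has_field_derivative_def)
      show "f M = f b" using insert M by simp
    qed (use M in \<open>auto intro: continuous_on_subset[OF cont]\<close>)
    then obtain z where z: "M < z" "z < b" "f' z = 0" by (metis mult.right_neutral)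
    have "Max (insert b A) = b"
      using insert by (intro Max_eqI) (auto intro: less_imp_le)
    moreover have "z \<notin> B" using B z by (auto simp: M_def)
    moreover have "b \<notin> A" using insert by auto
    ultimately show ?thesis
      using B z M insert
      by (intro exI[of _ "insert z B"]) (auto simp: M_def[symmetric])
  qed (use insert in \<open>auto intro!: exI[of _ "{}"]\<close>)
qed simp

lemma poly_powr_exp_tendsto_0:
  "((\<lambda>x. poly p x * x powr s * exp (- x)) \<longlongrightarrow> 0) at_top" for p :: "real poly"
proof (induction p arbitrary: s)
  case (pCons c p)
  have 1: "((\<lambda>x::real. x powr s * exp (- x)) \<longlongrightarrow> 0) at_top"
  proof (rule tendsto_sandwich[where f = "\<lambda>_. 0" and h = "\<lambda>x. x ^ nat \<lceil>s\<rceil> / exp x"])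
    let ?N = "nat \<lceil>s\<rceil>"
    show "((\<lambda>x::real. x ^ ?N / exp x) \<longlongrightarrow> 0) at_top" by (rule tendsto_power_div_exp_0)
    show "\<forall>\<^sub>F x::real in at_top. x powr s * exp (- x) \<le> x ^ ?N / exp x"
      using eventually_ge_at_top[of 1]
    proof eventually_elim
      case (elim x)
      have "x powr s \<le> x powr real ?N" using elim by (intro powr_mono) linarith+
      also have "\<dots> = x ^ ?N" using elim by (intro powr_realpow) auto
      finally show ?case by (simp add: exp_minus field_simps)
    qed
  qed (auto intro: always_eventually)
  have "((\<lambda>x. c * (x powr s * exp (- x)) + poly p x * x powr (s + 1) * exp (- x)) \<longlongrightarrow> c * 0 + 0) at_top"
    by (intro tendsto_intros 1 pCons.IH)
  moreover have "\<forall>\<^sub>F x in at_top. c * (x powr s * exp (- x)) + poly p x * x powr (s + 1) * exp (- x)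
       = poly (pCons c p) x * x powr s * exp (- x)"
    using eventually_gt_at_top[of 0] by eventually_elim (simp add: powr_add algebra_simps)
  ultimately show ?case by (simp add: tendsto_cong)
qed simp

text \<open>Induction on the degree. The function \<open>x powr (n + a) * exp (- x) * laguerre a n x\<close>
vanishes at 0, at the \<open>n\<close> roots, and at infinity, so its derivative has \<open>n + 1\<close> positive zeros.
The hypothesis \<open>a > 0\<close> makes the exponent positive even for \<open>n = 0\<close>.\<close>

lemma laguerre_roots_ex:
  assumes "a > 0"
  shows "\<exists>A. finite A \<and> card A = n \<and> A \<subseteq> {0<..} \<and> (\<forall>x\<in>A. poly (laguerre a n) x = 0)"
proof (induction n)
  case (Suc n)
  then obtain A where A: "finite A" "card A = n" "A \<subseteq> {0<..}" "\<And>x. x \<in> A \<Longrightarrow> poly (laguerre a n) x = 0"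
    by blast
  define s where "s = real n + a"
  have s: "s > 0" using assms by (simp add: s_def)
  define F where "F = (\<lambda>x. poly (laguerre a n) x * x powr s * exp (- x))"
  define F' where "F' = (\<lambda>x. x powr (s - 1) * exp (- x) * (s * poly (laguerre a (Suc n)) x))"
  have cont: "continuous_on {0..} F"
    unfolding F_def using s by (intro continuous_intros continuous_on_powr') auto
  have der: "(F has_real_derivative F' x) (at x)" if "x > 0" for x
  proof -
    have "x powr s = x powr (s - 1) * x"
      using that by (simp add: powr_diff)
    thus ?thesis
      unfolding F_def F'_def s_def laguerre_rec[OF assms]
      by (auto intro!: derivative_eq_intros that simp: algebra_simps)
  qed
  have Rolle: "\<exists>B. finite B \<and> Suc (card B) = card (insert 0 A) \<and> B \<subseteq> {0<..<Max (insert 0 A)} \<and> (\<forall>x\<in>B. F' x = 0)"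
    by (rule Rolle_finite[where f = F]) (use A cont der in \<open>auto simp: F_def\<close>)
  then obtain B where B: "finite B" "card B = n" "B \<subseteq> {0<..<Max (insert 0 A)}" "\<And>x. x \<in> B \<Longrightarrow> F' x = 0"
  proof -
    have "0 \<notin> A" using A(3) by auto
    thus ?thesis using A(1,2) Rolle that by auto
  qed
  define M where "M = Max (insert 0 A)"
  have M_in: "M \<in> insert 0 A"
    unfolding M_def by (rule Max_in) (use A in auto)
  hence M: "M \<in> insert 0 A" "M \<ge> 0" using A(3) by auto
  have "\<exists>x>M. F' x = 0"
  proof (rule Rolle_at_top[where f = F])
    show "F M = 0" using M A by (auto simp: F_def)
    show "(F \<longlongrightarrow> 0) at_top" unfolding F_def by (rule poly_powr_exp_tendsto_0)
  qed (use M der in \<open>auto intro: continuous_on_subset[OF cont]\<close>)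
  then obtain y where y: "y > M" "F' y = 0" by auto
  have "poly (laguerre a (Suc n)) x = 0" if "F' x = 0" "x > 0" for x
    using that s by (simp add: F'_def)
  moreover have "y \<notin> B" using B y by (auto simp: M_def)
  ultimately show ?case
    using B y M by (intro exI[of _ "insert y B"]) (auto simp: M_def[symmetric])
qed (auto intro!: exI[of _ "{}"])

section \<open>Root sums and convergence of the scaled Laguerre polynomials\<close>

definition laguerre_roots :: "real \<Rightarrow> nat \<Rightarrow> real set" where
  "laguerre_roots a n = {x. poly (laguerre a n) x = 0}"

lemma laguerre_roots:
  assumes "a > 0"
  shows "finite (laguerre_roots a n)" "card (laguerre_roots a n) = n" "laguerre_roots a n \<subseteq> {0<..}"
proof -
  show fin: "finite (laguerre_roots a n)"
    unfolding laguerre_roots_def by (rule poly_roots_finite[OF laguerre_nonzero[OF assms]])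
  obtain A where A: "finite A" "card A = n" "A \<subseteq> {0<..}" "\<forall>x\<in>A. poly (laguerre a n) x = 0"
    using laguerre_roots_ex[OF assms] by blast
  have "A \<subseteq> laguerre_roots a n" using A by (auto simp: laguerre_roots_def)
  moreover have "card (laguerre_roots a n) \<le> n"
    using card_poly_roots_bound[OF laguerre_nonzero[OF assms, of n]]
    by (simp add: laguerre_roots_def degree_laguerre assms)
  ultimately have "A = laguerre_roots a n"
    using A fin by (intro card_seteq) auto
  thus "card (laguerre_roots a n) = n" "laguerre_roots a n \<subseteq> {0<..}"
    using A by auto
qed

lemma poly_eq_prod_roots:
  fixes p :: "'a::idom poly"
  assumes "p \<noteq> 0" "finite A" "card A = degree p" "\<And>x. x \<in> A \<Longrightarrow> poly p x = 0"
  shows "p = smult (lead_coeff p) (\<Prod>x\<in>A. [:- x, 1:])"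
proof -
  have "\<exists>q. p = q * (\<Prod>x\<in>A. [:- x, 1:])"
    using assms(2,4)
  proof (induction A rule: finite_induct)
    case (insert x A)
    then obtain q where q: "p = q * (\<Prod>x\<in>A. [:- x, 1:])" by auto
    have "poly (\<Prod>x\<in>A. [:- x, 1:]) x \<noteq> 0"
      using insert.hyps by (auto simp: poly_prod)
    hence "poly q x = 0"
      using insert.prems[of x] q by auto
    then obtain r where r: "q = [:- x, 1:] * r"
      by (auto simp: poly_eq_0_iff_dvd)
    have "p = r * ([:- x, 1:] * (\<Prod>x\<in>A. [:- x, 1:]))"
      unfolding q r by (simp only: mult_ac)
    thus ?case
      using insert.hyps by (intro exI[of _ r]) (simp only: prod.insert not_False_eq_True)
  qed auto
  then obtain q where q: "p = q * (\<Prod>x\<in>A. [:- x, 1:])" by blast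
  have d: "degree (\<Prod>x\<in>A. [:- x, 1:]) = card A"
    by (subst degree_prod_eq_sum_degree) auto
  have "degree p = degree q + card A"
    using q assms(1) d by (metis degree_mult_eq mult_eq_0_iff)
  hence "degree q = 0" using assms by simp
  then obtain c where c: "q = [:c:]" by (metis degree_eq_zeroE)
  have "lead_coeff p = lead_coeff q * lead_coeff (\<Prod>x\<in>A. [:- x, 1:])"
    unfolding q by (rule lead_coeff_mult)
  also have "lead_coeff (\<Prod>x\<in>A. [:- x, 1:]) = 1"
    by (simp only: lead_coeff_prod) simp
  finally have "lead_coeff p = c"
    by (simp add: c)
  moreover have "p = smult c (\<Prod>x\<in>A. [:- x, 1:])" using q c by simp
  ultimately show ?thesis by metis
qed

lemma log_derivative_prod:
  fixes A :: "real set"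
  assumes "finite A" "u \<notin> A"
  shows "((\<lambda>u. \<Prod>x\<in>A. u - x) has_real_derivative (\<Prod>x\<in>A. u - x) * (\<Sum>x\<in>A. 1 / (u - x))) (at u)"
  using assms
proof (induction A rule: finite_induct)
  case (insert x A)
  show ?case
    using insert by (auto intro!: derivative_eq_intros simp: field_simps)
qed auto

text \<open>For a polynomial with \<open>degree p\<close> distinct roots, \<open>p' / p\<close> is the sum of \<open>1 / (u - x)\<close>
over the roots; the second identity is the derivative of the first.\<close>

lemma poly_root_sums:
  fixes p :: "real poly"
  assumes "p \<noteq> 0" "finite A" "card A = degree p" "\<And>x. x \<in> A \<Longrightarrow> poly p x = 0" "u \<notin> A"
  shows "poly (pderiv p) u = poly p u * (\<Sum>x\<in>A. 1 / (u - x))"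
    and "poly (pderiv (pderiv p)) u
           = poly p u * ((\<Sum>x\<in>A. 1 / (u - x))\<^sup>2 - (\<Sum>x\<in>A. 1 / (u - x)\<^sup>2))"
proof -
  let ?h = "\<lambda>u. \<Sum>x\<in>A. 1 / (u - x)"
  have p: "poly p u = lead_coeff p * (\<Prod>x\<in>A. u - x)" for u
    by (subst poly_eq_prod_roots[OF assms(1-4)]) (simp_all add: poly_prod)
  have 1: "poly (pderiv p) u = poly p u * ?h u" if "u \<notin> A" for u
  proof -
    have "(poly p has_real_derivative poly p u * ?h u) (at u)"
      using DERIV_cmult[OF log_derivative_prod[OF assms(2) that], of "lead_coeff p"]
      by (simp add: p[abs_def] mult_ac)
    thus ?thesis using poly_DERIV[of p u] by (rule DERIV_unique[symmetric])
  qed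
  show "poly (pderiv p) u = poly p u * ?h u" by (rule 1) fact
  have "(?h has_real_derivative - (\<Sum>x\<in>A. 1 / (u - x)\<^sup>2)) (at u)"
    unfolding sum_negf[symmetric]
    by (intro DERIV_sum) (use assms(5) in \<open>auto intro!: derivative_eq_intros simp: power2_eq_square\<close>)
  from DERIV_mult[OF poly_DERIV[of p u] this]
  have "((\<lambda>u. poly p u * ?h u) has_real_derivative
          poly p u * ((?h u)\<^sup>2 - (\<Sum>x\<in>A. 1 / (u - x)\<^sup>2))) (at u)"
    using 1[OF assms(5)] by (simp add: power2_eq_square algebra_simps)
  moreover have "\<forall>\<^sub>F v in nhds u. poly (pderiv p) v = poly p v * ?h v"
  proof -
    have "open (- A)" using assms(2) by (simp add: open_Compl finite_imp_closed)
    hence "\<forall>\<^sub>F v in nhds u. v \<in> - A" using assms(5) by (intro eventually_nhds_in_open) auto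
    thus ?thesis by eventually_elim (use 1 in auto)
  qed
  ultimately have "(poly (pderiv p) has_real_derivative
          poly p u * ((?h u)\<^sup>2 - (\<Sum>x\<in>A. 1 / (u - x)\<^sup>2))) (at u)"
    by (subst DERIV_cong_ev[OF refl _ refl]) auto
  thus "poly (pderiv (pderiv p)) u = poly p u * ((?h u)\<^sup>2 - (\<Sum>x\<in>A. 1 / (u - x)\<^sup>2))"
    using poly_DERIV[of "pderiv p" u] by (rule DERIV_unique[symmetric])
qed

text \<open>The factor \<open>1 / n\<close> in the argument turns the coefficients \<open>(n choose m)\<close> into
\<open>(n choose m) / n ^ m\<close>, which tend to \<open>1 / fact m\<close>.\<close>

definition scaled_laguerre :: "real \<Rightarrow> nat \<Rightarrow> real \<Rightarrow> real" where
  "scaled_laguerre a n z = poly (laguerre a n) (z / real n)"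

definition scaled_laguerre_deriv :: "real \<Rightarrow> nat \<Rightarrow> real \<Rightarrow> real" where
  "scaled_laguerre_deriv a n z = poly (pderiv (laguerre a n)) (z / real n) / real n"

definition scaled_laguerre_roots :: "real \<Rightarrow> nat \<Rightarrow> real set" where
  "scaled_laguerre_roots a n = {z. scaled_laguerre a n z = 0}"

lemma DERIV_scaled_laguerre: "(scaled_laguerre a n has_real_derivative scaled_laguerre_deriv a n z) (at z)"
  unfolding scaled_laguerre_def[abs_def] scaled_laguerre_deriv_def
  by (cases "n = 0") (auto intro!: derivative_eq_intros)

lemma scaled_laguerre_roots_eq: "n > 0 \<Longrightarrow> scaled_laguerre_roots a n = (\<lambda>x. real n * x) ` laguerre_roots a n"
  by (force simp: scaled_laguerre_roots_def scaled_laguerre_def laguerre_roots_def image_iff intro: exI[of _ "_ / real n"])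

lemma scaled_laguerre_roots:
  assumes "a > 0" "n > 0"
  shows "finite (scaled_laguerre_roots a n)" "scaled_laguerre_roots a n \<subseteq> {0<..}"
  using laguerre_roots[OF assms(1), of n] assms(2) by (auto simp: scaled_laguerre_roots_eq)

lemma sum_scaled_laguerre_roots:
  assumes "n > 0"
  shows "sum f (scaled_laguerre_roots a n) = (\<Sum>x\<in>laguerre_roots a n. f (real n * x))"
  unfolding scaled_laguerre_roots_eq[OF assms]
  by (subst sum.reindex) (use assms in \<open>auto intro: inj_onI\<close>)

text \<open>This is minus the logarithmic derivative at 0. Because the value does not depend on \<open>n\<close>, it
bounds the contribution of the large roots uniformly in \<open>n\<close>.\<close>

lemma sum_inverse_scaled_laguerre_roots:
  assumes "a > 0" "n > 0"
  shows "(\<Sum>x\<in>scaled_laguerre_roots a n. 1 / x) = 1 / a"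
proof -
  note R = laguerre_roots[OF assms(1), of n]
  have "poly (pderiv (laguerre a n)) 0
          = poly (laguerre a n) 0 * (\<Sum>x\<in>laguerre_roots a n. 1 / (0 - x))"
    by (rule poly_root_sums)
       (use R assms laguerre_nonzero[of a n] in \<open>auto simp: degree_laguerre laguerre_roots_def\<close>)
  moreover have "poly (pderiv (laguerre a n)) 0 = - real n / a"
    by (simp add: poly_0_coeff_0 coeff_pderiv coeff_laguerre)
  ultimately have "(\<Sum>x\<in>laguerre_roots a n. 1 / x) = real n / a"
    by (simp add: sum_negf)
  moreover have "(\<Sum>x\<in>scaled_laguerre_roots a n. 1 / x) = (\<Sum>x\<in>laguerre_roots a n. 1 / x) / real n"
    by (simp add: sum_scaled_laguerre_roots assms sum_divide_distrib mult.commute)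
  ultimately show ?thesis
    using assms by simp
qed

text \<open>The sum equals \<open>(p' / p)\<^sup>2 - p'' / p\<close>, and Laguerre's differential equation eliminates
\<open>p''\<close>; thus only the convergence of \<open>p\<close> and \<open>p'\<close> is needed afterwards.\<close>

lemma sum_scaled_laguerre_roots_resolvent:
  assumes "a > 0" "n > 0" "w \<noteq> 0" "scaled_laguerre a n w \<noteq> 0"
  defines "h \<equiv> scaled_laguerre_deriv a n w / scaled_laguerre a n w"
  shows "(\<Sum>x\<in>scaled_laguerre_roots a n. 1 / (w - x)\<^sup>2) = h\<^sup>2 + ((a - w / real n) * h + 1) / w"
proof -
  note R = laguerre_roots[OF assms(1), of n]
  define u where "u = w / real n"
  define S1 where "S1 = (\<Sum>x\<in>laguerre_roots a n. 1 / (u - x))"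
  define S2 where "S2 = (\<Sum>x\<in>laguerre_roots a n. 1 / (u - x)\<^sup>2)"
  define P where "P = poly (laguerre a n) u"
  have P: "P \<noteq> 0" using assms(4) by (simp add: P_def scaled_laguerre_def u_def)
  have u: "u \<notin> laguerre_roots a n" using P by (simp add: laguerre_roots_def P_def)
  have d1: "poly (pderiv (laguerre a n)) u = P * S1" unfolding P_def S1_def
    by (rule poly_root_sums)
       (use R assms u laguerre_nonzero[of a n] in \<open>auto simp: degree_laguerre laguerre_roots_def\<close>)
  have d2: "poly (pderiv (pderiv (laguerre a n))) u = P * (S1\<^sup>2 - S2)" unfolding P_def S1_def S2_def
    by (rule poly_root_sums)
       (use R assms u laguerre_nonzero[of a n] in \<open>auto simp: degree_laguerre laguerre_roots_def\<close>)
  have "P * (u * (S1\<^sup>2 - S2) + (a - u) * S1 + real n) = 0"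
    using laguerre_ode[OF assms(1), of u n] unfolding d1 d2 P_def[symmetric] by (simp add: algebra_simps)
  hence "u * (S1\<^sup>2 - S2) + (a - u) * S1 + real n = 0" using P by simp
  hence "u * S2 = u * S1\<^sup>2 + (a - u) * S1 + real n" by (simp add: algebra_simps)
  moreover have "u \<noteq> 0" using assms by (simp add: u_def)
  ultimately have S2: "S2 = S1\<^sup>2 + ((a - u) * S1 + real n) / u"
    by (simp add: field_simps)
  have h: "S1 = real n * h"
    using P assms(2) d1 by (simp add: h_def scaled_laguerre_def scaled_laguerre_deriv_def u_def[symmetric] P_def[symmetric])
  have "(\<Sum>x\<in>scaled_laguerre_roots a n. 1 / (w - x)\<^sup>2) = S2 / (real n)\<^sup>2"
  proof -
    have "w - real n * x = real n * (u - x)" for x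
      using assms(2) by (simp add: u_def algebra_simps)
    thus ?thesis
      using assms(2) by (simp add: sum_scaled_laguerre_roots S2_def power_mult_distrib sum_divide_distrib mult.commute)
  qed
  also have "\<dots> = h\<^sup>2 + ((a - w / real n) * h + 1) / w"
    unfolding S2 h u_def using assms(2,3) by (simp add: field_simps power2_eq_square)
  finally show ?thesis .
qed

definition falling_ratio :: "nat \<Rightarrow> nat \<Rightarrow> real" where
  "falling_ratio n m = real (n choose m) * fact m / real n ^ m"

lemma falling_ratio_bounds: "0 \<le> falling_ratio n m" "falling_ratio n m \<le> 1"
proof -
  have "real ((n choose m) * fact m) \<le> real (n ^ m)"
    by (subst of_nat_le_iff) (rule binomial_fact_pow)
  thus "falling_ratio n m \<le> 1"
    by (auto simp: falling_ratio_def divide_le_eq_1)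
qed (simp add: falling_ratio_def)

lemma falling_ratio_tendsto: "(\<lambda>n. falling_ratio n m) \<longlonglongrightarrow> 1"
proof (induction m)
  case (Suc m)
  have "(\<lambda>n. falling_ratio n m * (1 - real m / real n)) \<longlonglongrightarrow> 1 * (1 - 0)"
    by (intro tendsto_intros Suc lim_const_over_n)
  moreover have "\<forall>\<^sub>F n in sequentially. falling_ratio n m * (1 - real m / real n) = falling_ratio n (Suc m)"
    using eventually_gt_at_top[of 0]
  proof eventually_elim
    case (elim n)
    have "falling_ratio n (Suc m) = ((real m + 1) * real (n choose Suc m)) * fact m / (real n * real n ^ m)"
      by (simp add: falling_ratio_def algebra_simps)
    thus ?case
      using elim unfolding binomial_Suc_real by (simp add: falling_ratio_def field_simps)
  qed
  ultimately show ?case by (simp add: tendsto_cong)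
qed (simp add: falling_ratio_def)

lemma poly_as_series:
  fixes p :: "real poly"
  shows "poly p x = (\<Sum>m. coeff p m * x ^ m)"
  unfolding poly_altdef
  by (rule suminf_finite[symmetric]) (auto simp: coeff_eq_0)

lemma laguerre_coeff_scaled:
  "coeff (laguerre a n) m / real n ^ m = falling_ratio n m * bessel_coeff a m"
  by (simp add: coeff_laguerre falling_ratio_def bessel_coeff_def mult_ac)

lemma scaled_laguerre_series: "scaled_laguerre a n z = (\<Sum>m. falling_ratio n m * (bessel_coeff a m * z ^ m))"
  unfolding scaled_laguerre_def poly_as_series
  by (intro suminf_cong) (simp add: power_divide mult.assoc[symmetric] laguerre_coeff_scaled[symmetric])

lemma scaled_laguerre_deriv_series:
  "scaled_laguerre_deriv a n z = (\<Sum>m. falling_ratio n (Suc m) * (diffs (bessel_coeff a) m * z ^ m))"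
proof -
  let ?p = "pderiv (laguerre a n)"
  have s: "summable (\<lambda>m. coeff ?p m * (z / real n) ^ m)"
    by (rule summable_finite[of "{..degree ?p}"]) (auto simp: coeff_eq_0)
  have "scaled_laguerre_deriv a n z = (\<Sum>m. coeff ?p m * (z / real n) ^ m / real n)"
    unfolding scaled_laguerre_deriv_def poly_as_series by (rule suminf_divide[OF s, symmetric])
  also have "\<dots> = (\<Sum>m. falling_ratio n (Suc m) * (diffs (bessel_coeff a) m * z ^ m))"
  proof (rule suminf_cong)
    fix m
    have "coeff ?p m * (z / real n) ^ m / real n
            = real (Suc m) * (coeff (laguerre a n) (Suc m) / real n ^ Suc m) * z ^ m"
      by (simp add: coeff_pderiv power_divide mult_ac)
    also have "\<dots> = falling_ratio n (Suc m) * (diffs (bessel_coeff a) m * z ^ m)"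
      unfolding laguerre_coeff_scaled by (simp add: diffs_def)
    finally show "coeff ?p m * (z / real n) ^ m / real n
      = falling_ratio n (Suc m) * (diffs (bessel_coeff a) m * z ^ m)" .
  qed
  finally show ?thesis .
qed

text \<open>The difference is at most \<open>\<Sum>m. (1 - e n m) * \<bar>d m\<bar> * R ^ m\<close>, a bound that is free of
\<open>z\<close> and tends to 0 by Tannery's theorem.\<close>

lemma uniform_limit_multiplier_series:
  fixes d :: "nat \<Rightarrow> real"
  assumes sd: "summable (\<lambda>m. \<bar>d m\<bar> * R ^ m)"
    and e: "\<And>m n. 0 \<le> e n m" "\<And>m n. e n m \<le> 1" "\<And>m. (\<lambda>n. e n m) \<longlonglongrightarrow> 1"
  shows "uniform_limit {-R..R} (\<lambda>n z. \<Sum>m. e n m * (d m * z ^ m)) (\<lambda>z. \<Sum>m. d m * z ^ m) sequentially"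
proof (cases "R \<ge> 0")
  case R: True
  have E: "(\<lambda>n. \<Sum>m. (1 - e n m) * (\<bar>d m\<bar> * R ^ m)) \<longlonglongrightarrow> (\<Sum>m. 0)"
  proof (rule tannerys_theorem[THEN conjunct2, THEN conjunct2, OF _ _ sd])
    show "(\<lambda>n. (1 - e n m) * (\<bar>d m\<bar> * R ^ m)) \<longlonglongrightarrow> 0" for m
      by (rule tendsto_eq_intros e(3) refl | simp)+
    show "\<forall>\<^sub>F (m, n) in sequentially \<times>\<^sub>F sequentially.
            norm ((1 - e n m) * (\<bar>d m\<bar> * R ^ m)) \<le> \<bar>d m\<bar> * R ^ m"
      using e(1,2) R by (intro always_eventually) (auto simp: abs_mult intro!: mult_left_le_one_le)
  qed simp
  show ?thesis
  proof (rule uniform_limitI)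
    fix \<epsilon> :: real assume "\<epsilon> > 0"
    from order_tendstoD(2)[OF E, of \<epsilon>] this
    have "\<forall>\<^sub>F n in sequentially. (\<Sum>m. (1 - e n m) * (\<bar>d m\<bar> * R ^ m)) < \<epsilon>" by simp
    thus "\<forall>\<^sub>F n in sequentially. \<forall>z\<in>{-R..R}. dist (\<Sum>m. e n m * (d m * z ^ m)) (\<Sum>m. d m * z ^ m) < \<epsilon>"
    proof eventually_elim
      case (elim n)
      show ?case
      proof
        fix z assume z: "z \<in> {-R..R}"
        have dz: "\<bar>d m * z ^ m\<bar> \<le> \<bar>d m\<bar> * R ^ m" for m
          using z by (auto simp: abs_mult power_abs intro!: mult_left_mono power_mono)
        have sz: "summable (\<lambda>m. d m * z ^ m)"
          by (rule summable_comparison_test'[OF sd]) (use dz in auto)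
        have sE: "summable (\<lambda>m. (1 - e n m) * (\<bar>d m\<bar> * R ^ m))"
          by (rule summable_comparison_test'[OF sd])
             (use R e in \<open>auto simp: abs_mult intro!: mult_left_le_one_le\<close>)
        have sez: "summable (\<lambda>m. e n m * (d m * z ^ m))"
        proof (rule summable_comparison_test'[OF sd])
          show "norm (e n m * (d m * z ^ m)) \<le> \<bar>d m\<bar> * R ^ m" for m
            using mult_mono[OF e(2)[of n m] dz[of m]] e(1)[of n m] by (simp add: abs_mult)
        qed
        have "dist (\<Sum>m. e n m * (d m * z ^ m)) (\<Sum>m. d m * z ^ m)
                = norm (\<Sum>m. (1 - e n m) * (d m * z ^ m))"
          using suminf_diff[OF sz sez] by (simp add: dist_norm norm_minus_commute algebra_simps)
        also have "\<dots> \<le> (\<Sum>m. (1 - e n m) * (\<bar>d m\<bar> * R ^ m))"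
          by (rule norm_suminf_le[OF _ sE])
             (use dz e in \<open>auto simp: abs_mult[of "1 - _"] intro!: mult_left_mono\<close>)
        also have "\<dots> < \<epsilon>" by (rule elim)
        finally show "dist (\<Sum>m. e n m * (d m * z ^ m)) (\<Sum>m. d m * z ^ m) < \<epsilon>" .
      qed
    qed
  qed
qed simp

lemma scaled_laguerre_uniform_limit:
  assumes "a > 0"
  shows "uniform_limit {-R..R} (scaled_laguerre a) (bessel_entire a) sequentially"
proof (cases "R \<ge> 0")
  case True
  show ?thesis
    unfolding scaled_laguerre_series[abs_def] bessel_entire_def[abs_def]
    by (rule uniform_limit_multiplier_series)
       (use summable_abs_bessel_coeff[OF assms, of R] True in \<open>auto intro: falling_ratio_bounds falling_ratio_tendsto\<close>)
qed simp

lemma scaled_laguerre_deriv_uniform_limit: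
  assumes "a > 0"
  shows "uniform_limit {-R..R} (scaled_laguerre_deriv a) (\<lambda>z. - bessel_entire (a + 1) z / a) sequentially"
proof (cases "R \<ge> 0")
  case True
  have "- bessel_entire (a + 1) z / a = (\<Sum>m. diffs (bessel_coeff a) m * z ^ m)" for z
    using suminf_mult[OF summable_bessel_coeff[of "a + 1" z], of "- (1 / a)"] assms
    by (simp add: diffs_bessel_coeff[OF assms] bessel_entire_def mult_ac)
  moreover have "summable (\<lambda>m. \<bar>diffs (bessel_coeff a) m\<bar> * R ^ m)"
    using summable_mult[OF summable_abs_bessel_coeff[of "a + 1" R], of "1 / a"] assms True
    by (simp add: diffs_bessel_coeff[OF assms] mult_ac)
  ultimately show ?thesis
    unfolding scaled_laguerre_deriv_series[abs_def]
    by (auto intro!: uniform_limit_multiplier_series falling_ratio_bounds falling_ratio_tendsto[THEN LIMSEQ_ignore_initial_segment]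
             falling_ratio_tendsto)
qed simp

lemma scaled_laguerre_tendsto: "a > 0 \<Longrightarrow> (\<lambda>n. scaled_laguerre a n z) \<longlonglongrightarrow> bessel_entire a z"
  by (rule tendsto_uniform_limitI[OF scaled_laguerre_uniform_limit[of a "\<bar>z\<bar>"]]) auto

lemma scaled_laguerre_deriv_tendsto: "a > 0 \<Longrightarrow> (\<lambda>n. scaled_laguerre_deriv a n z) \<longlonglongrightarrow> - bessel_entire (a + 1) z / a"
  by (rule tendsto_uniform_limitI[OF scaled_laguerre_deriv_uniform_limit[of a "\<bar>z\<bar>"]]) auto

section \<open>Root sums in the limit\<close>

definition pos_zeros :: "real \<Rightarrow> real set" where
  "pos_zeros a = {z. 0 < z \<and> bessel_entire a z = 0}"

text \<open>With \<open>g = bessel_entire a\<close> and \<open>h = g' / g\<close> this is \<open>h\<^sup>2 - g'' / g\<close>, that is, \<open>- h'\<close>, where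
\<open>g''\<close> has been eliminated by \<open>z g'' + a g' + g = 0\<close>.\<close>

definition resolvent_value :: "real \<Rightarrow> real \<Rightarrow> real" where
  "resolvent_value a w =
     (let h = - bessel_entire (a + 1) w / a / bessel_entire a w in h\<^sup>2 + (a * h + 1) / w)"

lemma scaled_laguerre_resolvent_tendsto:
  assumes "a > 0" "w \<noteq> 0" "bessel_entire a w \<noteq> 0"
  shows "(\<lambda>n. \<Sum>x\<in>scaled_laguerre_roots a n. 1 / (w - x)\<^sup>2) \<longlonglongrightarrow> resolvent_value a w"
proof -
  let ?h = "\<lambda>n. scaled_laguerre_deriv a n w / scaled_laguerre a n w"
  have "(\<lambda>n. (?h n)\<^sup>2 + ((a - w / real n) * ?h n + 1) / w)
          \<longlonglongrightarrow> (- bessel_entire (a + 1) w / a / bessel_entire a w)\<^sup>2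
              + ((a - 0) * (- bessel_entire (a + 1) w / a / bessel_entire a w) + 1) / w"
    by (intro tendsto_intros scaled_laguerre_tendsto scaled_laguerre_deriv_tendsto lim_const_over_n assms)
  hence "(\<lambda>n. (?h n)\<^sup>2 + ((a - w / real n) * ?h n + 1) / w) \<longlonglongrightarrow> resolvent_value a w"
    by (simp add: resolvent_value_def Let_def)
  moreover have "\<forall>\<^sub>F n in sequentially. scaled_laguerre a n w \<noteq> 0"
    by (rule tendsto_imp_eventually_ne[OF scaled_laguerre_tendsto[OF assms(1)] assms(3)])
  hence "\<forall>\<^sub>F n in sequentially. (?h n)\<^sup>2 + ((a - w / real n) * ?h n + 1) / w
           = (\<Sum>x\<in>scaled_laguerre_roots a n. 1 / (w - x)\<^sup>2)"
    using eventually_gt_at_top[of 0]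
    by eventually_elim (rule sum_scaled_laguerre_roots_resolvent[symmetric, OF assms(1) _ assms(2)])
  ultimately show ?thesis
    by (simp add: tendsto_cong)
qed

lemma DERIV_nonzero_sign_change:
  fixes f :: "real \<Rightarrow> real"
  assumes "(f has_real_derivative l) (at z)" "l \<noteq> 0" "f z = 0" "\<epsilon> > 0"
  shows "\<exists>u v. z - \<epsilon> < u \<and> u < v \<and> v < z + \<epsilon> \<and> f u * f v < 0"
proof -
  have *: "\<exists>u v. z - \<epsilon> < u \<and> u < v \<and> v < z + \<epsilon> \<and> f u * f v < 0"
    if der: "(f has_real_derivative l) (at z)" and "l > 0" "f z = 0" for f l
  proof -
    obtain d1 where d1: "d1 > 0" "\<And>h. 0 < h \<Longrightarrow> h < d1 \<Longrightarrow> f z < f (z + h)"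
      using DERIV_pos_inc_right[OF der \<open>l > 0\<close>] by auto
    obtain d2 where d2: "d2 > 0" "\<And>h. 0 < h \<Longrightarrow> h < d2 \<Longrightarrow> f (z - h) < f z"
      using DERIV_pos_inc_left[OF der \<open>l > 0\<close>] by auto
    define h where "h = min \<epsilon> (min d1 d2) / 2"
    have h: "0 < h" "h < \<epsilon>" "h < d1" "h < d2"
      using d1(1) d2(1) \<open>\<epsilon> > 0\<close> by (auto simp: h_def min_def)
    have "f (z - h) * f (z + h) < 0"
      using d1(2)[of h] d2(2)[of h] h \<open>f z = 0\<close> by (intro mult_neg_pos) auto
    thus ?thesis using h by (intro exI[of _ "z - h"] exI[of _ "z + h"]) auto
  qed
  show ?thesis
  proof (cases "l > 0")
    case True
    show ?thesis by (rule *[OF assms(1) True assms(3)])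
  next
    case False
    show ?thesis using *[of "\<lambda>x. - f x" "- l"] assms False
      by (auto intro: DERIV_minus)
  qed
qed

text \<open>A simple zero is a sign change, and sign changes survive pointwise approximation.\<close>

lemma scaled_laguerre_root_near_zero:
  assumes "a > 0" "z \<in> pos_zeros a" "\<epsilon> > 0"
  shows "\<forall>\<^sub>F n in sequentially. \<exists>x\<in>scaled_laguerre_roots a n. \<bar>x - z\<bar> < \<epsilon>"
proof -
  have "- bessel_entire (a + 1) z / a \<noteq> 0"
    using bessel_entire_simple_zero[OF assms(1), of z] assms by (auto simp: pos_zeros_def)
  then obtain u v where uv: "z - \<epsilon> < u" "u < v" "v < z + \<epsilon>" "bessel_entire a u * bessel_entire a v < 0"
    using DERIV_nonzero_sign_change[OF DERIV_bessel_entire[OF assms(1)], of z \<epsilon>] assms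
    by (auto simp: pos_zeros_def)
  have "(\<lambda>n. scaled_laguerre a n u * scaled_laguerre a n v) \<longlonglongrightarrow> bessel_entire a u * bessel_entire a v"
    by (intro tendsto_intros scaled_laguerre_tendsto assms)
  hence "\<forall>\<^sub>F n in sequentially. scaled_laguerre a n u * scaled_laguerre a n v < 0"
    using uv(4) by (rule order_tendstoD)
  thus ?thesis
    using eventually_gt_at_top[of 0]
  proof eventually_elim
    case (elim n)
    have "\<exists>x>u / real n. x < v / real n \<and> poly (laguerre a n) x = 0"
      using elim uv by (intro poly_IVT) (auto simp: scaled_laguerre_def divide_strict_right_mono)
    then obtain x where x: "u / real n < x" "x < v / real n" "poly (laguerre a n) x = 0" by auto
    have "u < real n * x" "real n * x < v" using x elim by (auto simp: field_simps)
    moreover have "scaled_laguerre a n (real n * x) = 0" using x elim by (simp add: scaled_laguerre_def)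
    ultimately show ?case
      using uv by (intro bexI[of _ "real n * x"]) (auto simp: scaled_laguerre_roots_def)
  qed
qed

text \<open>The root nearest to \<open>z\<close> does the job.\<close>

lemma scaled_laguerre_root_sequence:
  assumes "a > 0" "z \<in> pos_zeros a"
  shows "\<exists>X. X \<longlonglongrightarrow> z \<and> (\<forall>\<^sub>F n in sequentially. X n \<in> scaled_laguerre_roots a n)"
proof -
  define X where "X = (\<lambda>n. arg_min_on (\<lambda>x. \<bar>x - z\<bar>) (scaled_laguerre_roots a n))"
  have X: "X n \<in> scaled_laguerre_roots a n \<and> \<bar>X n - z\<bar> < \<epsilon>"
    if n: "n > 0" and ex: "\<exists>x\<in>scaled_laguerre_roots a n. \<bar>x - z\<bar> < \<epsilon>" for n \<epsilon>
  proof -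
    obtain x where x: "x \<in> scaled_laguerre_roots a n" "\<bar>x - z\<bar> < \<epsilon>" using ex by auto
    have fin: "finite (scaled_laguerre_roots a n)" by (rule scaled_laguerre_roots(1)[OF assms(1) n])
    show ?thesis
      using arg_min_if_finite(1)[OF fin, of "\<lambda>x. \<bar>x - z\<bar>"] x
        arg_min_least[OF fin _ x(1), of "\<lambda>x. \<bar>x - z\<bar>"]
      unfolding X_def by fastforce
  qed
  have ev: "\<forall>\<^sub>F n in sequentially. X n \<in> scaled_laguerre_roots a n \<and> \<bar>X n - z\<bar> < \<epsilon>" if "\<epsilon> > 0" for \<epsilon>
    using scaled_laguerre_root_near_zero[OF assms that] eventually_gt_at_top[of 0]
    by eventually_elim (rule X)
  have "X \<longlonglongrightarrow> z"
  proof (rule tendstoI)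
    fix \<epsilon> :: real assume "\<epsilon> > 0"
    from ev[OF this] show "\<forall>\<^sub>F n in sequentially. dist (X n) z < \<epsilon>"
      by eventually_elim (simp add: dist_real_def)
  qed
  moreover have "\<forall>\<^sub>F n in sequentially. X n \<in> scaled_laguerre_roots a n"
    using ev[of 1] by (auto elim: eventually_mono)
  ultimately show ?thesis by blast
qed

text \<open>The lower half of the limit: finitely many zeros are limits of distinct roots, and the
remaining roots only increase the sum.\<close>

lemma sum_zeros_le:
  assumes "a > 0" "w \<noteq> 0" "bessel_entire a w \<noteq> 0" "finite F" "F \<subseteq> pos_zeros a"
  shows "(\<Sum>z\<in>F. 1 / (w - z)\<^sup>2) \<le> resolvent_value a w"
proof -
  have "\<forall>z\<in>F. \<exists>X. X \<longlonglongrightarrow> z \<and> (\<forall>\<^sub>F n in sequentially. X n \<in> scaled_laguerre_roots a n)"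
    using scaled_laguerre_root_sequence[OF assms(1)] assms(5) by blast
  then obtain X where X: "\<And>z. z \<in> F \<Longrightarrow> X z \<longlonglongrightarrow> z"
      "\<And>z. z \<in> F \<Longrightarrow> \<forall>\<^sub>F n in sequentially. X z n \<in> scaled_laguerre_roots a n"
    by metis
  have "(\<lambda>n. \<Sum>z\<in>F. 1 / (w - X z n)\<^sup>2) \<longlonglongrightarrow> (\<Sum>z\<in>F. 1 / (w - z)\<^sup>2)"
    by (intro tendsto_intros X) (use assms in \<open>auto simp: pos_zeros_def\<close>)
  moreover have "\<forall>\<^sub>F n in sequentially. (\<Sum>z\<in>F. 1 / (w - X z n)\<^sup>2) \<le> (\<Sum>x\<in>scaled_laguerre_roots a n. 1 / (w - x)\<^sup>2)"
  proof -
    have "\<forall>\<^sub>F n in sequentially. \<forall>z\<in>F. X z n \<in> scaled_laguerre_roots a n"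
      using X(2) assms(4) by (intro eventually_ball_finite) auto
    moreover have "\<forall>\<^sub>F n in sequentially. \<forall>z\<in>F. \<forall>z'\<in>F. z \<noteq> z' \<longrightarrow> X z n \<noteq> X z' n"
    proof (intro eventually_ball_finite assms(4) ballI)
      fix z z' assume zz: "z \<in> F" "z' \<in> F"
      show "\<forall>\<^sub>F n in sequentially. z \<noteq> z' \<longrightarrow> X z n \<noteq> X z' n"
      proof (cases "z = z'")
        case False
        have "(\<lambda>n. X z n - X z' n) \<longlonglongrightarrow> z - z'" by (intro tendsto_intros X zz)
        hence "\<forall>\<^sub>F n in sequentially. X z n - X z' n \<noteq> 0"
          using False by (intro tendsto_imp_eventually_ne) auto
        thus ?thesis by eventually_elim auto
      qed auto
    qed
    ultimately show ?thesis
      using eventually_gt_at_top[of 0]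
    proof eventually_elim
      case (elim n)
      have "inj_on (\<lambda>z. X z n) F" using elim by (auto intro: inj_onI)
      hence "(\<Sum>z\<in>F. 1 / (w - X z n)\<^sup>2) = (\<Sum>x\<in>(\<lambda>z. X z n) ` F. 1 / (w - x)\<^sup>2)"
        by (simp add: sum.reindex)
      also have "\<dots> \<le> (\<Sum>x\<in>scaled_laguerre_roots a n. 1 / (w - x)\<^sup>2)"
        using elim scaled_laguerre_roots(1)[OF assms(1)] by (intro sum_mono2) auto
      finally show ?case .
    qed
  qed
  ultimately show ?thesis
    by (intro tendsto_le[OF _ scaled_laguerre_resolvent_tendsto[OF assms(1-3)]]) auto
qed

lemma bessel_entire_minus_one: "a > 0 \<Longrightarrow> bessel_entire a (-1) > 0"
  unfolding bessel_entire_def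
proof (rule suminf_pos)
  assume a: "a > 0"
  show "0 < bessel_coeff a m * (-1) ^ m" for m
    using pochhammer_pos[OF a, of m] by (simp add: bessel_coeff_def power_mult_distrib[symmetric])
qed (rule summable_bessel_coeff)

text \<open>At \<open>w = -1\<close> each zero up to \<open>R\<close> contributes at least \<open>1 / (1 + R)\<^sup>2\<close> to a bounded sum.\<close>

lemma finite_pos_zeros_below:
  assumes "a > 0"
  shows "finite (pos_zeros a \<inter> {..R})"
proof (cases "R \<ge> 0")
  case True
  define C where "C = nat \<lceil>(1 + R)\<^sup>2 * resolvent_value a (-1)\<rceil>"
  have "card F \<le> C" if F: "F \<subseteq> pos_zeros a \<inter> {..R}" "finite F" for F
  proof -
    have "(\<Sum>z\<in>F. 1 / (1 + R)\<^sup>2) \<le> (\<Sum>z\<in>F. 1 / (-1 - z)\<^sup>2)"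
    proof (intro sum_mono divide_left_mono)
      fix z assume "z \<in> F"
      hence z: "0 < z" "z \<le> R" using F by (auto simp: pos_zeros_def)
      have "(-1 - z)\<^sup>2 = (1 + z)\<^sup>2" by (simp add: power2_eq_square algebra_simps)
      also have "\<dots> \<le> (1 + R)\<^sup>2" using z by (intro power_mono) auto
      finally show "(-1 - z)\<^sup>2 \<le> (1 + R)\<^sup>2" .
      show "0 < (1 + R)\<^sup>2 * (-1 - z)\<^sup>2" using z by (intro mult_pos_pos) auto
    qed auto
    also have "\<dots> \<le> resolvent_value a (-1)"
      using bessel_entire_minus_one[OF assms] F by (intro sum_zeros_le assms) auto
    finally have "real (card F) \<le> (1 + R)\<^sup>2 * resolvent_value a (-1)"
      using True by (simp add: field_simps)
    thus ?thesis unfolding C_def by linarith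
  qed
  thus ?thesis using finite_if_finite_subsets_card_bdd[of _ C] by blast
next
  case False
  hence "pos_zeros a \<inter> {..R} = {}" by (auto simp: pos_zeros_def)
  thus ?thesis by simp
qed

text \<open>Two roots near \<open>z\<close> would enclose a critical point, but the derivatives converge
uniformly to a function that does not vanish near \<open>z\<close>.\<close>

lemma scaled_laguerre_root_unique_near_zero:
  assumes "a > 0" "z \<in> pos_zeros a"
  shows "\<exists>\<delta>>0. \<forall>\<^sub>F n in sequentially. \<forall>x\<in>scaled_laguerre_roots a n. \<forall>y\<in>scaled_laguerre_roots a n.
           \<bar>x - z\<bar> < \<delta> \<longrightarrow> \<bar>y - z\<bar> < \<delta> \<longrightarrow> x = y"
proof -
  let ?g' = "\<lambda>z. - bessel_entire (a + 1) z / a"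
  have nz: "?g' z \<noteq> 0"
    using bessel_entire_simple_zero[OF assms(1), of z] assms by (auto simp: pos_zeros_def)
  have "isCont ?g' z"
    using assms by (intro continuous_intros isCont_bessel_entire) auto
  hence "\<forall>e>0. \<exists>d>0. \<forall>x. dist x z < d \<longrightarrow> dist (?g' x) (?g' z) < e"
    by (simp only: continuous_at_eps_delta)
  moreover have "\<bar>?g' z\<bar> / 2 > 0" using nz by simp
  ultimately
  obtain \<delta> where \<delta>: "\<delta> > 0" "\<And>x. dist x z < \<delta> \<Longrightarrow> dist (?g' x) (?g' z) < \<bar>?g' z\<bar> / 2"
    by blast
  have "uniform_limit {- (\<bar>z\<bar> + \<delta>)..\<bar>z\<bar> + \<delta>} (scaled_laguerre_deriv a) ?g' sequentially"
    by (rule scaled_laguerre_deriv_uniform_limit[OF assms(1)])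
  from uniform_limitD[OF this, of "\<bar>?g' z\<bar> / 2"] nz
  have "\<forall>\<^sub>F n in sequentially. \<forall>x\<in>{- (\<bar>z\<bar> + \<delta>)..\<bar>z\<bar> + \<delta>}. dist (scaled_laguerre_deriv a n x) (?g' x) < \<bar>?g' z\<bar> / 2"
    by auto
  hence "\<forall>\<^sub>F n in sequentially. \<forall>x\<in>scaled_laguerre_roots a n. \<forall>y\<in>scaled_laguerre_roots a n.
           \<bar>x - z\<bar> < \<delta> \<longrightarrow> \<bar>y - z\<bar> < \<delta> \<longrightarrow> x = y"
  proof eventually_elim
    case (elim n)
    have ne: "scaled_laguerre_deriv a n x \<noteq> 0" if "\<bar>x - z\<bar> < \<delta>" for x
    proof -
      have "x \<in> {- (\<bar>z\<bar> + \<delta>)..\<bar>z\<bar> + \<delta>}" using that by auto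
      with elim have "dist (scaled_laguerre_deriv a n x) (?g' x) < \<bar>?g' z\<bar> / 2" by blast
      moreover have "dist (?g' x) (?g' z) < \<bar>?g' z\<bar> / 2"
        using \<delta>(2)[of x] that by (simp only: dist_real_def)
      ultimately show ?thesis unfolding dist_real_def by argo
    qed
    have *: False if "x \<in> scaled_laguerre_roots a n" "y \<in> scaled_laguerre_roots a n" "\<bar>x - z\<bar> < \<delta>" "\<bar>y - z\<bar> < \<delta>" "x < y" for x y
    proof -
      have "\<exists>t. x < t \<and> t < y \<and> (*) (scaled_laguerre_deriv a n t) = (\<lambda>v. 0)"
      proof (rule Rolle_deriv)
        show "(scaled_laguerre a n has_derivative (*) (scaled_laguerre_deriv a n t)) (at t)" for t
          using DERIV_scaled_laguerre by (simp add: has_field_derivative_def)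
        show "continuous_on {x..y} (scaled_laguerre a n)"
          by (intro continuous_at_imp_continuous_on ballI DERIV_isCont[OF DERIV_scaled_laguerre])
      qed (use that in \<open>auto simp: scaled_laguerre_roots_def\<close>)
      then obtain t where "x < t" "t < y" "scaled_laguerre_deriv a n t = 0" by (metis mult.right_neutral)
      thus False using ne[of t] that by auto
    qed
    show ?case using * by (metis linorder_neq_iff)
  qed
  thus ?thesis using \<delta>(1) by blast
qed

text \<open>Away from its zeros, \<open>bessel_entire a\<close> is bounded away from 0 on a compact interval.\<close>

lemma scaled_laguerre_root_imp_near_zero:
  assumes "a > 0" "\<delta> > 0"
  shows "\<forall>\<^sub>F n in sequentially. \<forall>x\<in>scaled_laguerre_roots a n \<inter> {..R}. \<exists>z\<in>pos_zeros a \<inter> {..R}. \<bar>x - z\<bar> < \<delta>"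
proof -
  let ?Z = "pos_zeros a \<inter> {..R}"
  \<comment> \<open>Zeros above \<open>R\<close> have a positive distance from \<open>{0..R}\<close>, so removing balls around the other zeros suffices.\<close>
  define K where "K = {0..R} - (\<Union>z\<in>?Z. ball z \<delta>)"
  have K: "compact K" unfolding K_def by (intro compact_diff) auto
  have nz: "bessel_entire a x \<noteq> 0" if "x \<in> K" for x
  proof
    assume *: "bessel_entire a x = 0"
    hence "x \<noteq> 0" by auto
    hence "x \<in> ?Z" using that * by (auto simp: K_def pos_zeros_def)
    moreover have "x \<in> ball x \<delta>" using assms(2) by simp
    ultimately show False using that unfolding K_def by blast
  qed
  have "\<exists>c>0. \<forall>x\<in>K. c \<le> \<bar>bessel_entire a x\<bar>"
  proof (cases "K = {}")
    case False
    have "continuous_on K (\<lambda>x. \<bar>bessel_entire a x\<bar>)"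
      by (intro continuous_intros continuous_on_bessel_entire assms)
    from continuous_attains_inf[OF K False this] show ?thesis
      using nz by (metis zero_less_abs_iff)
  qed (auto intro: exI[of _ 1])
  then obtain c where c: "c > 0" "\<And>x. x \<in> K \<Longrightarrow> c \<le> \<bar>bessel_entire a x\<bar>" by blast
  have "\<forall>\<^sub>F n in sequentially. \<forall>x\<in>{-R..R}. dist (scaled_laguerre a n x) (bessel_entire a x) < c"
    by (rule uniform_limitD[OF scaled_laguerre_uniform_limit[OF assms(1)] c(1)])
  thus ?thesis using eventually_gt_at_top[of 0]
  proof eventually_elim
    case (elim n)
    show ?case
    proof
      fix x assume x: "x \<in> scaled_laguerre_roots a n \<inter> {..R}"
      hence "0 < x" "x \<le> R" using scaled_laguerre_roots(2)[OF assms(1) elim(2)] by auto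
      moreover from this have "dist (scaled_laguerre a n x) (bessel_entire a x) < c" using elim(1) by auto
      hence "\<bar>bessel_entire a x\<bar> < c" using x by (simp add: scaled_laguerre_roots_def dist_real_def)
      hence "x \<notin> K" using c(2) by force
      ultimately show "\<exists>z\<in>?Z. \<bar>x - z\<bar> < \<delta>"
        by (auto simp: K_def dist_real_def abs_minus_commute)
    qed
  qed
qed

lemma uniform_radius:
  fixes P :: "'a \<Rightarrow> real \<Rightarrow> bool"
  assumes "finite Z" "\<And>z. z \<in> Z \<Longrightarrow> \<exists>\<delta>>0. P z \<delta>"
    and "\<And>z \<delta> \<delta>'. P z \<delta> \<Longrightarrow> 0 < \<delta>' \<Longrightarrow> \<delta>' \<le> \<delta> \<Longrightarrow> P z \<delta>'"
  shows "\<exists>\<delta>>0. \<forall>z\<in>Z. P z \<delta>"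
  using assms(1,2)
proof (induction Z rule: finite_induct)
  case (insert x Z)
  obtain d1 where "d1 > 0" "P x d1" using insert.prems[of x] by blast
  moreover obtain d2 where "d2 > 0" "\<forall>z\<in>Z. P z d2" using insert.IH insert.prems by blast
  ultimately show ?case by (intro exI[of _ "min d1 d2"]) (auto intro: assms(3))
qed (auto intro: exI[of _ 1])

text \<open>The upper half of the limit. The roots up to \<open>R\<close> are matched injectively with zeros that lie
arbitrarily close to them; for the roots beyond \<open>R\<close>, the terms are at most
\<open>4 / (R * x)\<close>, and the sum of the \<open>1 / x\<close> is \<open>1 / a\<close>.\<close>

lemma resolvent_value_le:
  assumes "a > 0" "w \<noteq> 0" "bessel_entire a w \<noteq> 0" "R > 0" "R \<ge> 2 * \<bar>w\<bar>"
  shows "resolvent_value a w \<le> (\<Sum>z\<in>pos_zeros a \<inter> {..R}. 1 / (w - z)\<^sup>2) + 4 / (R * a)"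
proof (rule field_le_epsilon)
  fix e :: real assume e: "e > 0"
  let ?Z = "pos_zeros a \<inter> {..R}" and ?\<phi> = "\<lambda>z. 1 / (w - z)\<^sup>2"
  have fin: "finite ?Z" by (rule finite_pos_zeros_below[OF assms(1)])
  \<comment> \<open>The \<open>card ?Z\<close> matched terms are off by at most \<open>\<eta>\<close> each, \<open>e\<close> in total.\<close>
  define \<eta> where "\<eta> = e / (real (card ?Z) + 1)"
  have \<eta>: "\<eta> > 0" using e by (simp add: \<eta>_def add_nonneg_pos)
  have "\<exists>\<delta>>0. \<forall>z\<in>?Z. \<forall>x. \<bar>x - z\<bar> < \<delta> \<longrightarrow> ?\<phi> x \<le> ?\<phi> z + \<eta>"
  proof (rule uniform_radius[OF fin])
    fix z assume "z \<in> ?Z"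
    hence "w \<noteq> z" using assms(3) by (auto simp: pos_zeros_def)
    hence "isCont ?\<phi> z" by (intro continuous_intros) auto
    hence "\<forall>e>0. \<exists>d>0. \<forall>x. dist x z < d \<longrightarrow> dist (?\<phi> x) (?\<phi> z) < e"
      by (simp only: continuous_at_eps_delta)
    with \<eta> obtain \<delta> where "\<delta> > 0" "\<And>x. dist x z < \<delta> \<Longrightarrow> dist (?\<phi> x) (?\<phi> z) < \<eta>"
      by blast
    thus "\<exists>\<delta>>0. \<forall>x. \<bar>x - z\<bar> < \<delta> \<longrightarrow> ?\<phi> x \<le> ?\<phi> z + \<eta>"
      unfolding dist_real_def by (metis abs_diff_less_iff add.commute less_imp_le)
  qed auto
  then obtain \<delta>1 where \<delta>1: "\<delta>1 > 0" "\<And>z x. z \<in> ?Z \<Longrightarrow> \<bar>x - z\<bar> < \<delta>1 \<Longrightarrow> ?\<phi> x \<le> ?\<phi> z + \<eta>"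
    by blast
  let ?U = "\<lambda>z \<delta>. \<forall>\<^sub>F n in sequentially. \<forall>x\<in>scaled_laguerre_roots a n. \<forall>y\<in>scaled_laguerre_roots a n.
              \<bar>x - z\<bar> < \<delta> \<longrightarrow> \<bar>y - z\<bar> < \<delta> \<longrightarrow> x = y"
  have "\<exists>\<delta>>0. \<forall>z\<in>?Z. ?U z \<delta>"
  proof (rule uniform_radius[OF fin])
    show "\<exists>\<delta>>0. ?U z \<delta>" if "z \<in> ?Z" for z
      using scaled_laguerre_root_unique_near_zero[OF assms(1)] that by blast
    show "?U z \<delta>'" if "?U z \<delta>" "\<delta>' \<le> \<delta>" for z \<delta> \<delta>'
      using that(1) by eventually_elim (use that(2) in \<open>meson less_le_trans\<close>)
  qed
  then obtain \<delta>2 where \<delta>2: "\<delta>2 > 0" "\<And>z. z \<in> ?Z \<Longrightarrow> ?U z \<delta>2" by blast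
  define \<delta> where "\<delta> = min \<delta>1 \<delta>2"
  have "\<forall>\<^sub>F n in sequentially. \<forall>z\<in>?Z. \<forall>x\<in>scaled_laguerre_roots a n. \<forall>y\<in>scaled_laguerre_roots a n.
              \<bar>x - z\<bar> < \<delta>2 \<longrightarrow> \<bar>y - z\<bar> < \<delta>2 \<longrightarrow> x = y"
    by (intro eventually_ball_finite fin ballI \<delta>2(2))
  moreover have "\<forall>\<^sub>F n in sequentially. \<forall>x\<in>scaled_laguerre_roots a n \<inter> {..R}. \<exists>z\<in>?Z. \<bar>x - z\<bar> < \<delta>"
    by (rule scaled_laguerre_root_imp_near_zero) (use assms(1) \<delta>1 \<delta>2 in \<open>auto simp: \<delta>_def\<close>)
  ultimately have "\<forall>\<^sub>F n in sequentially. (\<Sum>x\<in>scaled_laguerre_roots a n. ?\<phi> x) \<le> (\<Sum>z\<in>?Z. ?\<phi> z) + 4 / (R * a) + e"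
    using eventually_gt_at_top[of 0]
  proof eventually_elim
    case (elim n)
    let ?X = "scaled_laguerre_roots a n"
    note X = scaled_laguerre_roots[OF assms(1) \<open>0 < n\<close>]
    obtain \<zeta> where \<zeta>: "\<And>x. x \<in> ?X \<inter> {..R} \<Longrightarrow> \<zeta> x \<in> ?Z \<and> \<bar>x - \<zeta> x\<bar> < \<delta>"
      using elim(2) by metis
    have inj: "inj_on \<zeta> (?X \<inter> {..R})"
    proof (rule inj_onI)
      fix x y assume xy: "x \<in> ?X \<inter> {..R}" "y \<in> ?X \<inter> {..R}" "\<zeta> x = \<zeta> y"
      show "x = y"
        using elim(1) \<zeta>[OF xy(1)] \<zeta>[OF xy(2)] xy unfolding \<delta>_def by (metis IntD1 min_less_iff_conj)
    qed
    have "(\<Sum>x\<in>?X \<inter> {..R}. ?\<phi> x) \<le> (\<Sum>x\<in>?X \<inter> {..R}. ?\<phi> (\<zeta> x) + \<eta>)"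
      using \<zeta> by (intro sum_mono \<delta>1(2)) (auto simp: \<delta>_def)
    also have "\<dots> = (\<Sum>z\<in>\<zeta> ` (?X \<inter> {..R}). ?\<phi> z + \<eta>)"
      using inj by (simp add: sum.reindex)
    also have "\<dots> \<le> (\<Sum>z\<in>?Z. ?\<phi> z + \<eta>)"
      using \<zeta> \<eta> by (intro sum_mono2 fin) (auto intro!: add_nonneg_nonneg)
    also have "\<dots> = (\<Sum>z\<in>?Z. ?\<phi> z) + real (card ?Z) * \<eta>"
      by (simp add: sum.distrib)
    also have "real (card ?Z) * \<eta> \<le> e"
      using e by (simp add: \<eta>_def field_simps)
    finally have 1: "(\<Sum>x\<in>?X \<inter> {..R}. ?\<phi> x) \<le> (\<Sum>z\<in>?Z. ?\<phi> z) + e" by simp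
    have "(\<Sum>x\<in>?X \<inter> {R<..}. ?\<phi> x) \<le> (\<Sum>x\<in>?X \<inter> {R<..}. 4 / R * (1 / x))"
    proof (rule sum_mono)
      fix x assume "x \<in> ?X \<inter> {R<..}"
      hence x: "x > R" by auto
      have "x / 2 \<le> x - w" using x assms(5) by linarith
      hence "(x / 2) * (x / 2) \<le> (x - w) * (x - w)"
        using x assms(4) by (intro mult_mono) auto
      hence "(x / 2) * (x / 2) \<le> (w - x)\<^sup>2" by (simp add: power2_eq_square algebra_simps)
      moreover have "R * x \<le> x * x" using x assms(4) by (intro mult_right_mono) auto
      ultimately have "R * x / 4 \<le> (w - x)\<^sup>2" by simp
      hence "?\<phi> x \<le> 1 / (R * x / 4)"
        using x assms(4) \<open>x / 2 \<le> x - w\<close> by (intro divide_left_mono) (auto intro!: mult_pos_pos)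
      thus "?\<phi> x \<le> 4 / R * (1 / x)" by simp
    qed
    also have "\<dots> \<le> (\<Sum>x\<in>?X. 4 / R * (1 / x))"
      using X assms(4) by (intro sum_mono2) (auto intro!: divide_nonneg_nonneg mult_nonneg_nonneg simp: subset_iff less_imp_le)
    also have "\<dots> = 4 / (R * a)"
      using sum_inverse_scaled_laguerre_roots[OF assms(1) \<open>0 < n\<close>] by (simp only: sum_distrib_left[symmetric]) simp
    finally have 2: "(\<Sum>x\<in>?X \<inter> {R<..}. ?\<phi> x) \<le> 4 / (R * a)" .
    have "?X = (?X \<inter> {..R}) \<union> (?X \<inter> {R<..})" by auto
    hence "(\<Sum>x\<in>?X. ?\<phi> x) = (\<Sum>x\<in>?X \<inter> {..R}. ?\<phi> x) + (\<Sum>x\<in>?X \<inter> {R<..}. ?\<phi> x)"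
      using X(1) by (subst sum.union_disjoint[symmetric]) auto
    with 1 2 show ?case by linarith
  qed
  thus "resolvent_value a w \<le> (\<Sum>z\<in>?Z. ?\<phi> z) + 4 / (R * a) + e"
    by (intro tendsto_upperbound[OF scaled_laguerre_resolvent_tendsto[OF assms(1-3)]]) auto
qed

text \<open>The partial fraction expansion of \<open>- (g' / g)'\<close> for \<open>g = bessel_entire a\<close>, which is usually
read off from the Hadamard product of \<open>g\<close>.\<close>

theorem has_sum_resolvent:
  assumes "a > 0" "w \<noteq> 0" "bessel_entire a w \<noteq> 0"
  shows "((\<lambda>z. 1 / (w - z)\<^sup>2) has_sum resolvent_value a w) (pos_zeros a)"
  unfolding has_sum_def
proof (rule tendstoI)
  fix e :: real assume e: "e > 0"
  \<comment> \<open>Any \<open>R > 4 / (a * e)\<close> makes the tail smaller than \<open>e\<close>.\<close>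
  define R where "R = max (2 * \<bar>w\<bar>) (8 / (a * e))"
  have R: "R > 0" "R \<ge> 2 * \<bar>w\<bar>" "8 / (a * e) \<le> R"
    using assms e by (auto simp: R_def)
  have "4 / (R * a) < e"
    using R(1,3) assms(1) e by (simp add: field_simps)
  hence low: "resolvent_value a w < (\<Sum>z\<in>pos_zeros a \<inter> {..R}. 1 / (w - z)\<^sup>2) + e"
    using resolvent_value_le[OF assms R(1,2)] by linarith
  show "\<forall>\<^sub>F F in finite_subsets_at_top (pos_zeros a).
          dist (\<Sum>z\<in>F. 1 / (w - z)\<^sup>2) (resolvent_value a w) < e"
    unfolding eventually_finite_subsets_at_top
  proof (intro exI[of _ "pos_zeros a \<inter> {..R}"] conjI allI impI finite_pos_zeros_below assms)
    fix F assume F: "finite F \<and> pos_zeros a \<inter> {..R} \<subseteq> F \<and> F \<subseteq> pos_zeros a"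
    have "(\<Sum>z\<in>pos_zeros a \<inter> {..R}. 1 / (w - z)\<^sup>2) \<le> (\<Sum>z\<in>F. 1 / (w - z)\<^sup>2)"
      using F by (intro sum_mono2) auto
    moreover have "(\<Sum>z\<in>F. 1 / (w - z)\<^sup>2) \<le> resolvent_value a w"
      using F assms by (intro sum_zeros_le) auto
    ultimately show "dist (\<Sum>z\<in>F. 1 / (w - z)\<^sup>2) (resolvent_value a w) < e"
      using low by (simp add: dist_real_def)
  qed auto
qed

text \<open>With finitely many zeros, \<open>w\<^sup>2\<close> times the sum would stay bounded as \<open>w\<close> grows, whereas
completing the square gives, with \<open>h = g' / g\<close>,
\<open>w\<^sup>2 * resolvent_value a w = (w * h + a / 2)\<^sup>2 + w - a\<^sup>2 / 4\<close>.\<close>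

lemma infinite_pos_zeros:
  assumes "a > 0"
  shows "infinite (pos_zeros a)"
proof
  assume fin: "finite (pos_zeros a)"
  define N where "N = real (card (pos_zeros a))"
  define M where "M = Max (insert 0 (pos_zeros a))"
  have M: "M \<ge> 0" "\<And>z. z \<in> pos_zeros a \<Longrightarrow> z \<le> M" using fin by (auto simp: M_def simp del: Max_insert)
  \<comment> \<open>\<open>2 * M\<close> keeps \<open>w\<close> at distance at least \<open>w / 2\<close> from all zeros, and \<open>a\<^sup>2 + 4 * N\<close> beats the term \<open>a\<^sup>2 / 4\<close> of the square and the bound \<open>4 * N\<close> on the sum.\<close>
  define w where "w = 2 * M + a\<^sup>2 + 4 * N + 1"
  have w: "w > 0" "w > 2 * M" using M by (auto simp: w_def N_def add_nonneg_pos)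
  have nz: "bessel_entire a w \<noteq> 0" using M(2)[of w] w M(1) by (auto simp: pos_zeros_def)
  define h where "h = - bessel_entire (a + 1) w / a / bessel_entire a w"
  have "resolvent_value a w = (\<Sum>z\<in>pos_zeros a. 1 / (w - z)\<^sup>2)"
    using has_sum_resolvent[OF assms _ nz] w has_sum_finite[OF fin] has_sum_unique by blast
  also have "\<dots> \<le> (\<Sum>z\<in>pos_zeros a. 4 / w\<^sup>2)"
  proof (rule sum_mono)
    fix z assume "z \<in> pos_zeros a"
    hence "w / 2 \<le> w - z" using M(2)[of z] w by linarith
    hence "(w / 2)\<^sup>2 \<le> (w - z)\<^sup>2" using w by (intro power_mono) auto
    hence "1 / (w - z)\<^sup>2 \<le> 1 / (w / 2)\<^sup>2"
      using w \<open>w / 2 \<le> w - z\<close> by (intro divide_left_mono) (auto intro!: mult_pos_pos)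
    thus "1 / (w - z)\<^sup>2 \<le> 4 / w\<^sup>2" by (simp add: power_divide)
  qed
  also have "\<dots> = 4 * N / w\<^sup>2" by (simp add: N_def)
  finally have "w\<^sup>2 * resolvent_value a w \<le> 4 * N" using w by (simp add: field_simps)
  moreover have "w\<^sup>2 * resolvent_value a w = (w * h + a / 2)\<^sup>2 + w - a\<^sup>2 / 4"
  proof -
    have "resolvent_value a w = h\<^sup>2 + (a * h + 1) / w"
      by (simp add: resolvent_value_def h_def Let_def)
    thus ?thesis using w by (simp add: field_simps power2_eq_square)
  qed
  ultimately have "w - a\<^sup>2 / 4 \<le> 4 * N" by (smt (verit) zero_le_power2)
  moreover have "a\<^sup>2 \<ge> 0" by simp
  ultimately show False using M(1) unfolding w_def by linarith
qed

text \<open>As \<open>g''\<close> is a multiple of \<open>bessel_entire (a + 2)\<close>, at such a point the differential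
equation reduces to \<open>a g' + g = 0\<close>, so \<open>h = - 1 / a\<close>.\<close>

lemma resolvent_value_at_zero_of_second_derivative:
  assumes "a > 0" "w > 0" "bessel_entire (a + 2) w = 0"
  shows "bessel_entire a w \<noteq> 0" "resolvent_value a w = 1 / a\<^sup>2"
proof -
  have eq: "bessel_entire (a + 1) w = bessel_entire a w"
    using bessel_entire_contiguous[OF assms(1), of w] assms(3) by simp
  show nz: "bessel_entire a w \<noteq> 0"
    using bessel_entire_simple_zero[OF assms(1), of w] eq assms(2) by auto
  have "- bessel_entire (a + 1) w / a / bessel_entire a w = - 1 / a"
    using nz eq by simp
  thus "resolvent_value a w = 1 / a\<^sup>2"
    using assms(1) unfolding resolvent_value_def Let_def by (simp add: power_divide)
qed

section \<open>Zeros of the Bessel function\<close>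

text \<open>Read with \<open>S\<close> the set of positive zeros of \<open>J\<^sub>\<mu>\<close>, this shows that the definite description in
\<open>bessel_zero\<close> enumerates all of them.\<close>

lemma bij_betw_nth_element:
  fixes S :: "real set"
  assumes inf: "infinite S" and fin: "\<And>x. finite (S \<inter> {..x})"
  shows "bij_betw (\<lambda>n. THE x. x \<in> S \<and> card (S \<inter> {..x}) = n) {1::nat..} S"
proof -
  define r where "r x = card (S \<inter> {..x})" for x
  have less: "r x < r y" if "x < y" "y \<in> S" for x y
  proof -
    have "y \<in> S \<inter> {..y}" "y \<notin> S \<inter> {..x}" "S \<inter> {..x} \<subseteq> S \<inter> {..y}" using that by auto
    thus ?thesis unfolding r_def by (intro psubset_card_mono fin) blast
  qed
  have inj: "inj_on r S"
    by (rule linorder_inj_onI') (use less in force)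
  have pos: "r x \<ge> 1" if "x \<in> S" for x
    using that fin[of x] card_gt_0_iff[of "S \<inter> {..x}"] unfolding r_def by force
  have ex: "\<exists>x\<in>S. r x = Suc n" for n
  proof (induction n)
    case 0
    obtain y where y: "y \<in> S" using inf by fastforce
    define x where "x = Min (S \<inter> {..y})"
    have ne: "S \<inter> {..y} \<noteq> {}" using y by auto
    have x: "x \<in> S \<inter> {..y}" unfolding x_def using fin ne by (rule Min_in)
    moreover have "S \<inter> {..x} = {x}"
    proof (intro equalityI subsetI)
      fix t assume t: "t \<in> S \<inter> {..x}"
      hence "t \<in> S \<inter> {..y}" using x by auto
      hence "x \<le> t" unfolding x_def by (intro Min_le fin)
      thus "t \<in> {x}" using t by auto
    qed (use x in auto)
    ultimately show ?case by (intro bexI[of _ x]) (auto simp: r_def)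
  next
    case (Suc n)
    then obtain x where x: "x \<in> S" "r x = Suc n" by auto
    have "infinite (S - (S \<inter> {..x}))" using inf fin by (rule Diff_infinite_finite[rotated])
    then obtain y where y: "y \<in> S" "y > x" by (metis Diff_iff IntI atMost_iff ex_in_conv finite.emptyI not_le)
    define m where "m = Min (S \<inter> {x<..y})"
    have f: "finite (S \<inter> {x<..y})" by (rule finite_subset[OF _ fin[of y]]) auto
    have "S \<inter> {x<..y} \<noteq> {}" using y by auto
    with f have m: "m \<in> S \<inter> {x<..y}" unfolding m_def by (rule Min_in)
    have "S \<inter> {..m} = insert m (S \<inter> {..x})"
    proof (intro equalityI subsetI)
      fix t assume t: "t \<in> S \<inter> {..m}"
      show "t \<in> insert m (S \<inter> {..x})"
      proof (cases "t \<le> x")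
        case False
        hence "m \<le> t" unfolding m_def using t m by (intro Min_le f) auto
        thus ?thesis using t by auto
      qed (use t in auto)
    qed (use m in auto)
    hence "r m = Suc (r x)" unfolding r_def using m fin[of x] by simp
    thus ?case using m x by auto
  qed
  have the: "(THE x. x \<in> S \<and> r x = n) = y" if "y \<in> S" "r y = n" for y n
    using that inj by (auto dest: inj_onD)
  show ?thesis
    unfolding r_def[symmetric]
  proof (rule bij_betw_byWitness[where f' = r])
    have *: "\<exists>x\<in>S. r x = n" if "n \<ge> 1" for n
      using ex[of "n - 1"] that by simp
    show "\<forall>n\<in>{1..}. r (THE x. x \<in> S \<and> r x = n) = n"
      using * the by (metis atLeast_iff)
    show "(\<lambda>n. THE x. x \<in> S \<and> r x = n) ` {1..} \<subseteq> S"
      using * the by (smt (verit, best) atLeast_iff image_subsetI)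
  qed (use the pos in auto)
qed

lemma bij_betw_bessel_J_zeros:
  assumes "\<mu> > -1"
  shows "bij_betw (\<lambda>x. x\<^sup>2 / 4) {x. 0 < x \<and> bessel_J \<mu> x = 0} (pos_zeros (\<mu> + 1))"
proof (rule bij_betw_byWitness[where f' = "\<lambda>z. 2 * sqrt z"])
  show "(\<lambda>z. 2 * sqrt z) ` pos_zeros (\<mu> + 1) \<subseteq> {x. 0 < x \<and> bessel_J \<mu> x = 0}"
    using assms by (auto simp: pos_zeros_def bessel_J_zero_iff power_mult_distrib)
qed (use assms in \<open>auto simp: pos_zeros_def bessel_J_zero_iff power_mult_distrib real_sqrt_divide\<close>)

lemma bij_betw_bessel_zero:
  assumes "\<mu> > -1"
  shows "bij_betw (bessel_zero \<mu>) {1..} {x. 0 < x \<and> bessel_J \<mu> x = 0}"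
proof -
  define S where "S = {x. 0 < x \<and> bessel_J \<mu> x = 0}"
  note bij = bij_betw_bessel_J_zeros[OF assms, folded S_def]
  have a: "\<mu> + 1 > 0" using assms by simp
  have "infinite S"
    using bij_betw_finite[OF bij] infinite_pos_zeros[OF a] by simp
  moreover have "finite (S \<inter> {..x})" for x
  proof (rule inj_on_finite[where f = "\<lambda>x. x\<^sup>2 / 4"])
    show "inj_on (\<lambda>x. x\<^sup>2 / 4) (S \<inter> {..x})"
      using bij by (auto simp: bij_betw_def intro: inj_on_subset)
    show "(\<lambda>x. x\<^sup>2 / 4) ` (S \<inter> {..x}) \<subseteq> pos_zeros (\<mu> + 1) \<inter> {..x\<^sup>2 / 4}"
      using bij by (auto simp: bij_betw_def S_def power_mono)
    show "finite (pos_zeros (\<mu> + 1) \<inter> {..x\<^sup>2 / 4})"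
      by (rule finite_pos_zeros_below[OF a])
  qed
  ultimately have "bij_betw (\<lambda>n. THE x. x \<in> S \<and> card (S \<inter> {..x}) = n) {1..} S"
    by (rule bij_betw_nth_element)
  moreover have "S \<inter> {..x} = {y. 0 < y \<and> y \<le> x \<and> bessel_J \<mu> y = 0}" for x
    by (auto simp: S_def)
  ultimately show ?thesis
    by (simp add: bessel_zero_def[abs_def] S_def conj_assoc)
qed

theorem mainTheorem10:
  fixes \<nu> :: real and n :: nat
  assumes "\<nu> > -1" and "n \<ge> 1"
  shows "((\<lambda>k. 1 / ((bessel_zero (\<nu> + 2) n)\<^sup>2 - (bessel_zero \<nu> k)\<^sup>2)\<^sup>2)
           has_sum (1 / (16 * (\<nu> + 1)\<^sup>2))) {1::nat..}"
proof -
  define a where "a = \<nu> + 1"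
  have a: "a > 0" using assms by (simp add: a_def)
  define w where "w = (bessel_zero (\<nu> + 2) n)\<^sup>2 / 4"
  have "bij_betw (\<lambda>n. (bessel_zero (\<nu> + 2) n)\<^sup>2 / 4) {1..} (pos_zeros (a + 2))"
    using bij_betw_trans[OF bij_betw_bessel_zero bij_betw_bessel_J_zeros, of "\<nu> + 2"] assms
    by (simp add: o_def a_def add_ac)
  hence "w \<in> pos_zeros (a + 2)"
    using assms unfolding w_def by (auto dest: bij_betwE)
  hence w: "w > 0" "bessel_entire (a + 2) w = 0" by (auto simp: pos_zeros_def)
  have "((\<lambda>z. 1 / (w - z)\<^sup>2) has_sum 1 / a\<^sup>2) (pos_zeros a)"
    using has_sum_resolvent[of a w] resolvent_value_at_zero_of_second_derivative[OF a w] a w by simp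
  moreover have "bij_betw (\<lambda>k. (bessel_zero \<nu> k)\<^sup>2 / 4) {1..} (pos_zeros a)"
    using bij_betw_trans[OF bij_betw_bessel_zero bij_betw_bessel_J_zeros, of \<nu>] assms
    by (simp add: o_def a_def)
  ultimately have "((\<lambda>k. 1 / (w - (bessel_zero \<nu> k)\<^sup>2 / 4)\<^sup>2) has_sum 1 / a\<^sup>2) {1..}"
    by (simp add: has_sum_reindex_bij_betw[where f = "\<lambda>z. 1 / (w - z)\<^sup>2"])
  \<comment> \<open>The factor 1/16 is the square of the 1/4 in the substitution \<open>z = x\<^sup>2 / 4\<close>.\<close>
  hence "((\<lambda>k. 1 / 16 * (1 / (w - (bessel_zero \<nu> k)\<^sup>2 / 4)\<^sup>2)) has_sum 1 / 16 * (1 / a\<^sup>2)) {1..}"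
    by (rule has_sum_cmult_right)
  moreover have "1 / 16 * (1 / (w - (bessel_zero \<nu> k)\<^sup>2 / 4)\<^sup>2)
      = 1 / ((bessel_zero (\<nu> + 2) n)\<^sup>2 - (bessel_zero \<nu> k)\<^sup>2)\<^sup>2" for k
    unfolding w_def diff_divide_distrib[symmetric] by (simp add: power_divide)
  ultimately show ?thesis
    by (simp add: a_def)
qed

end
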